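(* Let $G$ be a finite attributed undirected graph and let $k$ be such that the $k$-HON $G^{(k)}$ is connected and non-bipartite. Let $\mathrm{R}$ be an equivalence-isomorphic relation on $\mathcal{S}^{(k)}$, let $g:\mathcal{S}^{(k)}\to\mathbb{R}$ be a function such that $\sum_{S\in\mathcal{S}^{(k)}}\frac{\alpha(\mathrm{R},S)}{|C_{\mathrm{R},S}|}\neq 0$, and let $P$ be a pattern. For $t>1$ let $\mathcal{M}_t=(S_1,\dots,S_t)$ be the subgraphs visited by the simple random walk on $G^{(k)}$ in $t$ steps (counted with repetition). Consider the estimator $$\hat F(t,q,G,\mathrm{R},P)=\frac{1}{\hat\lambda}\sum_{S\in\mathcal{M}_t}\frac{\hat\alpha_1(q,\mathrm{R},S)\,\mathbf{1}_{\{\rho(S)=P\}}}{\hat\alpha_2(q,\mathrm{R},S)},\qquad \hat\lambda=\sum_{S\in\mathcal{M}_t}\frac{\hat\alpha_1(q,\mathrm{R},S)}{\hat\alpha_2(q,\mathrm{R},S)},$$ where $\hat\alpha_1(q,\mathrm{R},S)$ is the $q$-tour estimator of $\alpha(\mathrm{R},S)$, $\hat\alpha_2(q,\mathrm{R},S)$ is the $q$-tour estimator of $\sum_{S'\in C_{\mathrm{R},S}}|N^{(k)}(S')|$, and the number of tours $q$ is proportional to $t$ (that is, $q=\lceil ct\rceil$ for some constant $c>0$). Then $\hat F$ is consistent: $$\lim_{t\to\infty}\hat F(t,q,G,\mathrm{R},P)=F(G,\mathrm{R},P)\quad\text{almost surely},$$ where $$F(G,\mathrm{R},P)=\frac1\lambda\sum_{S\in\mathcal{S}^{(k)}}\frac{\alpha(\mathrm{R},S)}{|C_{\mathrm{R},S}|}\mathbf{1}_{\{\rho(S)=P\}},\qquad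 \lambda=\sum_{S\in\mathcal{S}^{(k)}}\frac{\alpha(\mathrm{R},S)}{|C_{\mathrm{R},S}|}.$$
   Context: $G=(V,E,\Phi)$ is a finite simple undirected graph with node labels $\Phi$. $\mathcal{S}^{(k)}$ is the set of all connected induced subgraphs of $G$ with exactly $k$ nodes. $\rho(S)$, the pattern of $S$, is a canonical form of the labeled graph $S$: $\rho(S)=\rho(S')$ iff $S$ and $S'$ are isomorphic by a label-preserving isomorphism. A relation $\mathrm{R}$ on $\mathcal{S}^{(k)}$ is equivalence-isomorphic if it is reflexive, symmetric, transitive, and $S\mathrm{R}S'$ implies $\rho(S)=\rho(S')$. $\mathbf{1}_{\{S'\mathrm{R}S\}}$ equals $1$ if $S'\mathrm{R}S$ and $0$ otherwise. $C_{\mathrm{R},S}=\{S'\in\mathcal{S}^{(k)} : S'\mathrm{R}S\}$ and $\alpha(\mathrm{R},S)=\sum_{S'\in\mathcal{S}^{(k)}}g(S')\,\mathbf{1}_{\{S'\mathrm{R}S\}}$. The $k$-HON of $G$ is the simple undirected graph $G^{(k)}=(\mathcal{S}^{(k)},E^{(k)})$ in which $S,S'$ are adjacent iff $|V(S)\cap V(S')|=k-1$; $N^{(k)}(S)$ is the neighborhood of $S$ in $G^{(k)}$. The simple random walk on $G^{(k)}$ moves from its current state to a uniformly chosen neighbor; its initial state is arbitrary. Non-backtracking random walk (nRW) on $G^{(k)}$: the second-order Markov chain that, having current state $S'$ and previous state $S''\in N^{(k)}(S')$, moves to a neighbor $S\in N^{(k)}(S')$ with probability $0$ if $S=S''$ and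 $|N^{(k)}(S')|>1$; $1$ if $S=S''$ and $|N^{(k)}(S')|=1$; and $\frac{1}{|N^{(k)}(S')|-1}$ for any other neighbor $S$. Tours: for each $S\in\mathcal{S}^{(k)}$ fix a nonempty set $\mathcal{I}_S\subseteq C_{\mathrm{R},S}$ (the supernode). A tour from $\mathcal{I}_S$ is a random path $\mathcal{T}=(U_1,\dots,U_T)$, $|\mathcal{T}|=T$, whose first step $(U_1,U_2)$ is uniform among all pairs with $U_1\in\mathcal{I}_S$, $U_2\in N^{(k)}(U_1)\setminus\mathcal{I}_S$, and which then continues as an nRW on $G^{(k)}$ until the first time $T>1$ with $U_T\in\mathcal{I}_S$. $q$-tour estimator: for a function $f:\mathcal{S}^{(k)}\to\mathbb{R}$ and $q$ independent tours $\mathcal{T}^1,\dots,\mathcal{T}^q$ from $\mathcal{I}_S$ with $\mathcal{T}^r=(S^r_1,\dots,S^r_{|\mathcal{T}^r|})$, the $q$-tour estimator of $\sum_{S'\in C_{\mathrm{R},S}}f(S')$ is $$\frac{\sum_{S'\in\mathcal{I}_S}|N^{(k)}(S')\setminus\mathcal{I}_S|}{q}\sum_{r=1}^{q}\sum_{i=2}^{|\mathcal{T}^r|-1}\frac{f(S^r_i)\,\mathbf{1}_{\{S^r_i\mathrm{R}S\}}}{|N^{(k)}(S^r_i)|}+\sum_{S'\in\mathcal{I}_S}f(S')\,\mathbf{1}_{\{S'\mathrm{R}S\}},$$ where the first term is read as $0$ if $\mathcal{I}_S=\mathcal{S}^{(k)}$. $\hat\alpha_1$ uses $f=g$ and $\hat\alpha_2$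 uses $f(S')=|N^{(k)}(S')|$. Sampling scheme: conditionally on the upper random walk $(S_1,S_2,\dots)$, each visit $i$ is equipped with an infinite i.i.d. sequence of tours from $\mathcal{I}_{S_i}$, these sequences being independent for different $i$; the values $\hat\alpha_1(q,\mathrm{R},S_i)$ and $\hat\alpha_2(q,\mathrm{R},S_i)$ in $\hat F$ are computed from the first $q$ tours of the sequence of visit $i$. (For finite $t$, $\hat F$ may be assigned any value when $\hat\lambda=0$.) *)

theory Defs
  imports "HOL-Probability.Probability" "Graph_Theory.Graph_Theory"
begin

text \<open>
  A finite simple undirected graph is a \<open>pair_graph\<close>: a finite, loop-free, symmetric digraph whose
  arcs are ordered pairs. The name \<open>connected\<close> is qualified to tell the graph-theoretic notion from
  the topological one; the former excludes the empty graph.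
\<close>

definition connected_subgraphs :: "nat \<Rightarrow> 'v pair_pre_digraph \<Rightarrow> 'v pair_pre_digraph set" where
  "connected_subgraphs k G =
     {S. induced_subgraph (with_proj S) (with_proj G)
       \<and> Digraph_Component.connected (with_proj S) \<and> card (pverts S) = k}"

definition label_isomorphic ::
  "('v \<Rightarrow> 'l) \<Rightarrow> 'v pair_pre_digraph \<Rightarrow> 'v pair_pre_digraph \<Rightarrow> bool" where
  "label_isomorphic \<Phi> S S' \<longleftrightarrow>
     (\<exists>h. pre_digraph.digraph_isomorphism (with_proj S) h
        \<and> with_proj S' = app_iso h (with_proj S)
        \<and> (\<forall>v\<in>pverts S. \<Phi> (iso_verts h v) = \<Phi> v))"

definition pattern_map ::
  "('v \<Rightarrow> 'l) \<Rightarrow> nat \<Rightarrow> 'v pair_pre_digraph \<Rightarrow> ('v pair_pre_digraph \<Rightarrow> 'p) \<Rightarrow> bool" where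
  "pattern_map \<Phi> k G \<rho> \<longleftrightarrow>
     (\<forall>S\<in>connected_subgraphs k G. \<forall>S'\<in>connected_subgraphs k G.
        \<rho> S = \<rho> S' \<longleftrightarrow> label_isomorphic \<Phi> S S')"

definition equivalence_isomorphic ::
  "nat \<Rightarrow> 'v pair_pre_digraph \<Rightarrow> ('v pair_pre_digraph \<Rightarrow> 'p) \<Rightarrow> 'v pair_pre_digraph rel \<Rightarrow> bool" where
  "equivalence_isomorphic k G \<rho> R \<longleftrightarrow>
     equiv (connected_subgraphs k G) R \<and> (\<forall>(S, S')\<in>R. \<rho> S = \<rho> S')"

text \<open>The intersection size is \<open>k - 1\<close>; the sum form avoids truncated subtraction.\<close>

definition hon :: "nat \<Rightarrow> 'v pair_pre_digraph \<Rightarrow> 'v pair_pre_digraph pair_pre_digraph" where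
  "hon k G =
     \<lparr>pverts = connected_subgraphs k G,
      parcs = {(S, S'). S \<in> connected_subgraphs k G \<and> S' \<in> connected_subgraphs k G
                 \<and> card (pverts S \<inter> pverts S') + 1 = k}\<rparr>"

definition bipartite :: "'a pair_pre_digraph \<Rightarrow> bool" where
  "bipartite H \<longleftrightarrow>
     (\<exists>A B. A \<inter> B = {} \<and> A \<union> B = pverts H \<and> parcs H \<subseteq> A \<times> B \<union> B \<times> A)"

definition nbrs :: "'a pair_pre_digraph \<Rightarrow> 'a \<Rightarrow> 'a set" where
  "nbrs H s = {s'. (s, s') \<in> parcs H}"

definition rel_class :: "'a pair_pre_digraph \<Rightarrow> 'a rel \<Rightarrow> 'a \<Rightarrow> 'a set" where
  "rel_class H R s = {s' \<in> pverts H. (s', s) \<in> R}"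

definition class_sum :: "'a pair_pre_digraph \<Rightarrow> 'a rel \<Rightarrow> ('a \<Rightarrow> real) \<Rightarrow> 'a \<Rightarrow> real" where
  "class_sum H R f s = (\<Sum>s'\<in>pverts H. f s' * of_bool ((s', s) \<in> R))"

text \<open>
  The walk is indexed from \<open>0\<close>, so \<open>X i\<close> is its \<open>(i+1)\<close>-st state. The law of \<open>X 0\<close> is unconstrained.
\<close>

definition simple_random_walk ::
  "'w measure \<Rightarrow> 'a pair_pre_digraph \<Rightarrow> (nat \<Rightarrow> 'w \<Rightarrow> 'a) \<Rightarrow> bool" where
  "simple_random_walk M H X \<longleftrightarrow>
     (\<forall>n. X n \<in> M \<rightarrow>\<^sub>M count_space (pverts H)) \<and>
     (\<forall>n x y. \<P>(\<omega> in M. \<forall>i\<le>n. X i \<omega> = x i) > 0 \<longrightarrow>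
        \<P>(\<omega> in M. X (Suc n) \<omega> = y \<bar> \<forall>i\<le>n. X i \<omega> = x i) = pmf (pmf_of_set (nbrs H (x n))) y)"

definition nrw_step :: "'a pair_pre_digraph \<Rightarrow> 'a \<Rightarrow> 'a \<Rightarrow> 'a pmf" where
  "nrw_step H prev cur =
     pmf_of_set (if card (nbrs H cur) > 1 then nbrs H cur - {prev} else nbrs H cur)"

lemma pmf_nrw_step:
  assumes "finite (nbrs H cur)" "prev \<in> nbrs H cur" "s \<in> nbrs H cur"
  shows "pmf (nrw_step H prev cur) s =
    (if s = prev then (if card (nbrs H cur) > 1 then 0 else 1)
     else 1 / real (card (nbrs H cur) - 1))"
proof (cases "card (nbrs H cur) > 1")
  case True
  have "card (nbrs H cur - {prev}) = card (nbrs H cur) - 1"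
    using assms by simp
  moreover from this True have "nbrs H cur - {prev} \<noteq> {}"
    by (metis card.empty less_numeral_extra(3) zero_less_diff)
  ultimately show ?thesis
    using True assms by (simp add: nrw_step_def)
next
  case False
  then have "card (nbrs H cur) = 1"
    using assms by (metis One_nat_def Suc_lessI card_gt_0_iff empty_iff)
  then have "nbrs H cur = {prev}"
    using assms(2) by (metis card_1_singletonE singletonD)
  then show ?thesis
    using assms(3) by (simp add: nrw_step_def pmf_of_set_singleton)
qed

text \<open>
  The path \<open>cur, \<dots>\<close> of the non-backtracking walk up to and including its first state in \<open>I\<close>. Any mass
  of runs that never meet \<open>I\<close> is left on \<open>None\<close> by the least fixed point.
\<close>

partial_function (spmf) nrw_until ::
  "'a pair_pre_digraph \<Rightarrow> 'a set \<Rightarrow> 'a \<Rightarrow> 'a \<Rightarrow> 'a list spmf" where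
  "nrw_until H I prev cur =
     (if cur \<in> I then return_spmf [cur]
      else bind_spmf (spmf_of_pmf (nrw_step H prev cur))
             (\<lambda>nxt. map_spmf ((#) cur) (nrw_until H I cur nxt)))"

text \<open>If no arc leaves \<open>I\<close>, no tour exists and all mass is on \<open>None\<close>.\<close>

definition tour_law :: "'a pair_pre_digraph \<Rightarrow> 'a set \<Rightarrow> 'a list spmf" where
  "tour_law H I =
     bind_spmf (spmf_of_set {(u1, u2). u1 \<in> I \<and> u2 \<in> nbrs H u1 - I})
       (\<lambda>(u1, u2). map_spmf ((#) u1) (nrw_until H I u1 u2))"

definition walk_algebra ::
  "'w measure \<Rightarrow> 'a pair_pre_digraph \<Rightarrow> (nat \<Rightarrow> 'w \<Rightarrow> 'a) \<Rightarrow> 'w measure" where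
  "walk_algebra M H X =
     vimage_algebra (space M) (\<lambda>\<omega> i. X i \<omega>) (\<Pi>\<^sub>M i\<in>(UNIV :: nat set). count_space (pverts H))"

text \<open>
  \<open>T i r\<close> is the \<open>r\<close>-th tour attached to visit \<open>i\<close>. Conditionally on the whole walk \<open>X\<close>, all tours are
  independent and \<open>T i r\<close> has the tour law of the supernode \<open>I (X i)\<close>.
\<close>

definition tour_sampling ::
  "'w measure \<Rightarrow> 'a pair_pre_digraph \<Rightarrow> ('a \<Rightarrow> 'a set) \<Rightarrow> (nat \<Rightarrow> 'w \<Rightarrow> 'a)
     \<Rightarrow> (nat \<Rightarrow> nat \<Rightarrow> 'w \<Rightarrow> 'a list option) \<Rightarrow> bool" where
  "tour_sampling M H I X T \<longleftrightarrow>
     (\<forall>i r. T i r \<in> M \<rightarrow>\<^sub>M count_space UNIV) \<and>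
     (\<forall>J \<tau>. finite J \<longrightarrow>
        (AE \<omega> in M.
           real_cond_exp M (walk_algebra M H X)
             (indicator {\<omega> \<in> space M. \<forall>(i, r)\<in>J. T i r \<omega> = \<tau> i r}) \<omega>
           = (\<Prod>(i, r)\<in>J. pmf (tour_law H (I (X i \<omega>))) (\<tau> i r))))"

text \<open>
  List positions start at \<open>0\<close>, so the interior of a tour \<open>u\<close> is \<open>u ! 1, \<dots>, u ! (length u - 2)\<close>. If \<open>I\<close>
  is the whole vertex set, the factor in front of the first term is \<open>0\<close>.
\<close>

definition tour_sum ::
  "'a pair_pre_digraph \<Rightarrow> 'a rel \<Rightarrow> ('a \<Rightarrow> real) \<Rightarrow> 'a \<Rightarrow> 'a list option \<Rightarrow> real" where
  "tour_sum H R f s \<tau> =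
     (case \<tau> of
        None \<Rightarrow> 0
      | Some u \<Rightarrow> \<Sum>i = 1..<length u - 1.
          f (u ! i) * of_bool ((u ! i, s) \<in> R) / real (card (nbrs H (u ! i))))"

definition tour_estimator ::
  "'a pair_pre_digraph \<Rightarrow> 'a rel \<Rightarrow> 'a set \<Rightarrow> ('a \<Rightarrow> real) \<Rightarrow> 'a \<Rightarrow> nat
     \<Rightarrow> (nat \<Rightarrow> 'a list option) \<Rightarrow> real" where
  "tour_estimator H R I f s q \<tau>s =
     real (\<Sum>s'\<in>I. card (nbrs H s' - I)) / real q * (\<Sum>r<q. tour_sum H R f s (\<tau>s r))
     + (\<Sum>s'\<in>I. f s' * of_bool ((s', s) \<in> R))"

text \<open>
  The values below are for one realisation: \<open>x\<close> is the walk, \<open>\<tau> i r\<close> the tours, and \<open>d\<close> the value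
  assigned when the normalisation vanishes.
\<close>

definition visit_ratio ::
  "'a pair_pre_digraph \<Rightarrow> 'a rel \<Rightarrow> ('a \<Rightarrow> 'a set) \<Rightarrow> ('a \<Rightarrow> real) \<Rightarrow> nat \<Rightarrow> 'a
     \<Rightarrow> (nat \<Rightarrow> 'a list option) \<Rightarrow> real" where
  "visit_ratio H R I g q s \<tau>s =
     tour_estimator H R (I s) g s q \<tau>s
     / tour_estimator H R (I s) (\<lambda>s'. real (card (nbrs H s'))) s q \<tau>s"

definition F_hat ::
  "'a pair_pre_digraph \<Rightarrow> 'a rel \<Rightarrow> ('a \<Rightarrow> 'p) \<Rightarrow> 'p \<Rightarrow> ('a \<Rightarrow> 'a set) \<Rightarrow> ('a \<Rightarrow> real)
     \<Rightarrow> nat \<Rightarrow> nat \<Rightarrow> (nat \<Rightarrow> 'a) \<Rightarrow> (nat \<Rightarrow> nat \<Rightarrow> 'a list option) \<Rightarrow> real \<Rightarrow> real" where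
  "F_hat H R \<rho> P I g t q x \<tau> d =
     (let l = (\<Sum>i<t. visit_ratio H R I g q (x i) (\<tau> i))
      in if l = 0 then d
         else (1 / l) * (\<Sum>i<t. visit_ratio H R I g q (x i) (\<tau> i) * of_bool (\<rho> (x i) = P)))"

definition F_norm :: "'a pair_pre_digraph \<Rightarrow> 'a rel \<Rightarrow> ('a \<Rightarrow> real) \<Rightarrow> real" where
  "F_norm H R g = (\<Sum>s\<in>pverts H. class_sum H R g s / real (card (rel_class H R s)))"

definition F_true ::
  "'a pair_pre_digraph \<Rightarrow> 'a rel \<Rightarrow> ('a \<Rightarrow> 'p) \<Rightarrow> 'p \<Rightarrow> ('a \<Rightarrow> real) \<Rightarrow> real" where
  "F_true H R \<rho> P g =
     (1 / F_norm H R g) *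
     (\<Sum>s\<in>pverts H. class_sum H R g s / real (card (rel_class H R s)) * of_bool (\<rho> s = P))"

end

theory Submission
  imports Defs
begin

text \<open>
  The denominator of a visit ratio is at least \<open>1\<close>, so the ratio differs from
  \<open>\<alpha>(s) / \<Sum>\<^bsub>s' R s\<^esub> deg s'\<close> by at most a constant times the deviations of the two estimators. Those
  deviations are averages of \<open>q\<close> i.i.d. centred variables with finite fourth moment, so the fourth
  moment of the mean deviation over \<open>t\<close> visits is \<open>O(1 / t\<^sup>2)\<close>, which is summable. It remains to average
  a fixed function along the simple random walk. Its stationary law is proportional to the degree,
  and summing the degrees over a class cancels the denominator.

  Tours are centred because the non-backtracking walk is doubly stochastic on arcs; the ergodic
  theorem follows from Poisson's equation and the same fourth moment bound for martingales.
\<close>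

section \<open>Transient kernels on finite sets\<close>

text \<open>Second moments would not do: with \<open>q\<close> of order \<open>t\<close> they bound
  the mean squared deviation by \<open>O(1 / t)\<close> only, which is not summable. Summability is
  the right target because the estimates for different \<open>t\<close> reuse the same tours, so
  almost sure convergence is read off from the expectation of a whole series. Two chains have to die
  out exponentially: the walk killed at one vertex, whose resolvent solves Poisson's equation, and
  the arc chain of the non-backtracking walk killed at the supernode, which gives tour lengths a
  finite fourth moment. One criterion serves both: a finite substochastic kernel without a closed
  class loses its mass geometrically. A further obstacle is that the conditional law of the tours is
  prescribed on single paths only, while the type of paths may be uncountable. Laws of events must
  therefore be recovered from point probabilities before independence becomes available.\<close>

primrec survival :: "'b set \<Rightarrow> ('b \<Rightarrow> 'b \<Rightarrow> real) \<Rightarrow> nat \<Rightarrow> 'b \<Rightarrow> real" where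
  "survival S Q 0 a = 1"
| "survival S Q (Suc n) a = (\<Sum>b\<in>S. Q a b * survival S Q n b)"

text \<open>\<open>survival S Q n\<close> lists the row sums of the \<open>n\<close>-th power of
  \<open>Q\<close>: the chance that a chain, killed with the mass missing from its rows, is alive
  after \<open>n\<close> steps. Row sums within a subset \<open>B\<close> are at most 1, so
  \<open>\<noteq> 1\<close> in \<open>no_closed_class\<close> says that some state of
  \<open>B\<close> loses mass out of \<open>B\<close>.\<close>

locale transient_kernel =
  fixes S :: "'b set" and Q :: "'b \<Rightarrow> 'b \<Rightarrow> real"
  assumes finite_states: "finite S"
    and kernel_nonneg: "\<And>a b. a \<in> S \<Longrightarrow> b \<in> S \<Longrightarrow> 0 \<le> Q a b"
    and row_sum_le: "\<And>a. a \<in> S \<Longrightarrow> (\<Sum>b\<in>S. Q a b) \<le> 1"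
    and no_closed_class: "\<And>B. B \<subseteq> S \<Longrightarrow> B \<noteq> {} \<Longrightarrow> \<exists>a\<in>B. (\<Sum>b\<in>B. Q a b) \<noteq> 1"
begin

abbreviation "s \<equiv> survival S Q"

lemma survival_decreasing: "a \<in> S \<Longrightarrow> s (Suc n) a \<le> s n a"
proof (induction n arbitrary: a)
  case 0
  then show ?case using row_sum_le by simp
next
  case (Suc n)
  have "(\<Sum>b\<in>S. Q a b * s (Suc n) b) \<le> (\<Sum>b\<in>S. Q a b * s n b)"
    using Suc by (intro sum_mono mult_left_mono kernel_nonneg) auto
  then show ?case by simp
qed

lemma survival_antimono: "a \<in> S \<Longrightarrow> m \<le> n \<Longrightarrow> s n a \<le> s m a"
  using lift_Suc_antimono_le[of "\<lambda>n. s n a"] survival_decreasing by blast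

lemma survival_le_1: "a \<in> S \<Longrightarrow> s n a \<le> 1"
  using survival_antimono[of a 0 n] by simp

text \<open>States that survive forever with probability 1 can move only among each other, so they
  would form a closed class. Finiteness of \<open>S\<close> turns the individual times into one
  \<open>N\<close>.\<close>

lemma survival_less_1: "\<exists>N. \<forall>a\<in>S. s N a < 1"
proof -
  define B where "B = {a\<in>S. \<forall>n. s n a = 1}"
  have "\<forall>b\<in>S - B. \<exists>n. s n b < 1"
  proof
    fix b assume b: "b \<in> S - B"
    then obtain n where "s n b \<noteq> 1" unfolding B_def by blast
    with survival_le_1[of b n] b have "s n b < 1" by simp
    then show "\<exists>n. s n b < 1" ..
  qed
  then obtain n where n: "\<And>b. b \<in> S - B \<Longrightarrow> s (n b) b < 1" by metis
  define N where "N = Max (insert 0 (n ` (S - B)))"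
  have N: "s N b < 1" if "b \<in> S - B" for b
  proof -
    have "n b \<le> N" unfolding N_def using that finite_states by (intro Max_ge) auto
    then show ?thesis using n[OF that] survival_antimono[of b "n b" N] that by auto
  qed
  have "B = {}"
  proof (rule ccontr)
    assume "B \<noteq> {}"
    then obtain a where a: "a \<in> B" "(\<Sum>b\<in>B. Q a b) \<noteq> 1"
      using no_closed_class[of B] unfolding B_def by auto
    then have aS: "a \<in> S" unfolding B_def by auto
    have 1: "(\<Sum>b\<in>S. Q a b * s N b) = 1"
      using a(1) unfolding B_def by (metis (mono_tags, lifting) mem_Collect_eq survival.simps(2))
    have le: "(\<Sum>b\<in>S. Q a b * s N b) \<le> (\<Sum>b\<in>S. Q a b)"
      using survival_le_1 kernel_nonneg aS
      by (intro sum_mono) (simp add: mult_left_le)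
    \<comment> \<open>Equality must hold in \<open>1\<close>, \<open>le\<close> and
      \<open>row_sum_le\<close> at once, so \<open>a\<close> gives no mass to states whose survival
      at time \<open>N\<close> is below 1, that is, to states outside \<open>B\<close>.\<close>
    have "(\<Sum>b\<in>S. Q a b) = 1" using 1 le row_sum_le[OF aS] by linarith
    then have "(\<Sum>b\<in>S. Q a b * (1 - s N b)) = 0"
      using 1 by (simp add: right_diff_distrib sum_subtractf)
    then have z: "\<forall>b\<in>S. Q a b * (1 - s N b) = 0"
      using survival_le_1 kernel_nonneg aS finite_states
      by (subst (asm) sum_nonneg_eq_0_iff) auto
    have "(\<Sum>b\<in>S. Q a b) = (\<Sum>b\<in>B. Q a b)"
    proof (rule sum.mono_neutral_right[OF finite_states])
      show "\<forall>b\<in>S - B. Q a b = 0" using z N by force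
    qed (auto simp: B_def)
    then show False using a(2) \<open>(\<Sum>b\<in>S. Q a b) = 1\<close> by simp
  qed
  then show ?thesis using N by blast
qed

text \<open>From any state at most a fraction \<delta> survives a block of \<open>N\<close> steps,
  and this repeats block by block. \<gamma> is the \<open>N\<close>-th root of \<delta>; the factor
  \<open>1 / \<delta>\<close> pays for the last incomplete block.\<close>

lemma survival_geometric:
  obtains C \<gamma> :: real where "0 < C" "0 < \<gamma>" "\<gamma> < 1" "\<And>a n. a \<in> S \<Longrightarrow> s n a \<le> C * \<gamma> ^ n"
proof -
  obtain N where N: "\<forall>a\<in>S. s N a < 1" using survival_less_1 by blast
  \<comment> \<open>The inserted \<open>1/2\<close> keeps \<delta> positive, as the root and the
    division require, and the maximum meaningful for empty \<open>S\<close>.\<close>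
  define \<delta> where "\<delta> = Max (insert (1/2) (s N ` S))"
  have "\<delta> < 1" and le: "\<And>x. x \<in> insert (1/2) (s N ` S) \<Longrightarrow> x \<le> \<delta>"
    unfolding \<delta>_def using N finite_states by (auto intro!: Max_ge simp del: Max_insert)
  then have \<delta>: "1/2 \<le> \<delta>" "\<delta> < 1" and le\<delta>: "\<And>a. a \<in> S \<Longrightarrow> s N a \<le> \<delta>"
    by (blast intro: le)+
  show thesis
  proof (cases "S = {}")
    case True
    then show thesis using that[of 1 "1/2"] by simp
  next
    case False
    then have N0: "N > 0" using N by (metis bot_nat_0.not_eq_extremum equals0I less_irrefl survival.simps(1))
    have step: "s (n + N) a \<le> \<delta> * s n a" if "a \<in> S" for a n
      using that
    proof (induction n arbitrary: a)
      case 0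
      then show ?case using le\<delta> by simp
    next
      case (Suc n)
      have "(\<Sum>b\<in>S. Q a b * s (n + N) b) \<le> (\<Sum>b\<in>S. Q a b * (\<delta> * s n b))"
        using Suc kernel_nonneg by (intro sum_mono mult_left_mono) auto
      then show ?case by (simp add: sum_distrib_left mult_ac)
    qed
    define \<gamma> where "\<gamma> = root N \<delta>"
    have \<gamma>N: "\<gamma> ^ N = \<delta>" unfolding \<gamma>_def using N0 \<delta> by (simp add: real_root_pow_pos2)
    have \<gamma>: "0 < \<gamma>" "\<gamma> < 1" unfolding \<gamma>_def using N0 \<delta> by (auto simp: real_root_lt_1_iff)
    have bound: "s n a \<le> 1 / \<delta> * \<gamma> ^ n" if "a \<in> S" for a n
      using that
    proof (induction n rule: less_induct)
      case (less n)
      show ?case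
      proof (cases "n < N")
        case True
        have "\<delta> \<le> \<gamma> ^ n" using \<gamma> True unfolding \<gamma>N[symmetric] by (intro power_decreasing) auto
        then have "1 \<le> 1 / \<delta> * \<gamma> ^ n" using \<delta> by (simp add: field_simps)
        then show ?thesis using survival_le_1[OF less.prems, of n] by linarith
      next
        case False
        then have "s n a \<le> \<delta> * s (n - N) a" using step[OF less.prems, of "n - N"] by simp
        also have "\<dots> \<le> \<delta> * (1 / \<delta> * \<gamma> ^ (n - N))"
          using less.IH[of "n - N"] less.prems False N0 \<delta> by (intro mult_left_mono) auto
        also have "\<dots> = 1 / \<delta> * (\<gamma> ^ N * \<gamma> ^ (n - N))" unfolding \<gamma>N by simp
        also have "\<dots> = 1 / \<delta> * \<gamma> ^ n" using False by (simp flip: power_add)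
        finally show ?thesis .
      qed
    qed
    show thesis using that[of "1 / \<delta>" \<gamma>] bound \<gamma> \<delta> by simp
  qed
qed

text \<open>Neumann series: \<open>w n\<close> is the \<open>n\<close>-th power of \<open>Q\<close>
  applied to \<phi>. It is dominated by a multiple of the survival probability, hence
  summable.\<close>

lemma resolvent_solution:
  obtains h where "\<And>a. a \<in> S \<Longrightarrow> h a = \<phi> a + (\<Sum>b\<in>S. Q a b * h b)"
proof -
  define w where "w = rec_nat \<phi> (\<lambda>_ w a. \<Sum>b\<in>S. Q a b * w b)"
  have w0: "w 0 = \<phi>" and wS: "\<And>n a. w (Suc n) a = (\<Sum>b\<in>S. Q a b * w n b)"
    unfolding w_def by auto
  obtain K where K: "\<And>a. a \<in> S \<Longrightarrow> \<bar>\<phi> a\<bar> \<le> K"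
    using finite_states by (metis Max_ge finite_imageI imageI)
  have bound: "\<bar>w n a\<bar> \<le> K * s n a" if "a \<in> S" for a n
    using that
  proof (induction n arbitrary: a)
    case 0
    then show ?case using K by (simp add: w0)
  next
    case (Suc n)
    have "\<bar>\<Sum>b\<in>S. Q a b * w n b\<bar> \<le> (\<Sum>b\<in>S. Q a b * (K * s n b))"
      using Suc kernel_nonneg
      by (intro order_trans[OF sum_abs] sum_mono) (auto simp: abs_mult intro!: mult_mono)
    then show ?case by (simp add: wS sum_distrib_left mult_ac)
  qed
  obtain C \<gamma> where C: "0 < C" "0 < \<gamma>" "\<gamma> < 1" "\<And>a n. a \<in> S \<Longrightarrow> s n a \<le> C * \<gamma> ^ n"
    using survival_geometric by blast
  have summ: "summable (\<lambda>n. w n a)" if "a \<in> S" for a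
  proof (rule summable_comparison_test'[where N=0])
    show "summable (\<lambda>n. K * C * \<gamma> ^ n)" using C by (intro summable_mult summable_geometric) auto
    have "0 \<le> K" using K[OF that] by linarith
    show "norm (w n a) \<le> K * C * \<gamma> ^ n" for n
    proof -
      have "\<bar>w n a\<bar> \<le> K * s n a" using bound[OF that] .
      also have "\<dots> \<le> K * (C * \<gamma> ^ n)" using C(4)[OF that] \<open>0 \<le> K\<close> by (intro mult_left_mono) auto
      finally show ?thesis by simp
    qed
  qed
  define h where "h a = (\<Sum>n. w n a)" for a
  have "h a = \<phi> a + (\<Sum>b\<in>S. Q a b * h b)" if "a \<in> S" for a
  proof -
    have "h a = w 0 a + (\<Sum>n. w (Suc n) a)"
      unfolding h_def using suminf_split_head[OF summ[OF that]] by simp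
    also have "(\<Sum>n. w (Suc n) a) = (\<Sum>b\<in>S. \<Sum>n. Q a b * w n b)"
      unfolding wS using summ by (intro suminf_sum summable_mult) auto
    also have "\<dots> = (\<Sum>b\<in>S. Q a b * h b)"
      unfolding h_def using summ by (intro sum.cong refl suminf_mult) auto
    finally show ?thesis by (simp add: w0)
  qed
  then show thesis by (rule that)
qed

end

section \<open>Moments\<close>

lemma summable_power4_geometric:
  fixes \<gamma> :: real
  assumes "0 < \<gamma>" "\<gamma> < 1"
  shows "summable (\<lambda>n. real n ^ 4 * \<gamma> ^ n)"
proof (rule root_test_convergence)
  show "(\<lambda>n. root n (norm (real n ^ 4 * \<gamma> ^ n))) \<longlonglongrightarrow> 1 ^ 4 * \<gamma>"
  proof (rule Lim_transform_eventually)
    show "(\<lambda>n. root n (real n) ^ 4 * \<gamma>) \<longlonglongrightarrow> 1 ^ 4 * \<gamma>"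
      by (intro tendsto_intros LIMSEQ_root)
    show "\<forall>\<^sub>F n in sequentially. root n (real n) ^ 4 * \<gamma> = root n (norm (real n ^ 4 * \<gamma> ^ n))"
      using eventually_gt_at_top[of 0]
    proof eventually_elim
      case (elim n)
      have "norm (real n ^ 4 * \<gamma> ^ n) = real n ^ 4 * \<gamma> ^ n" using assms by simp
      then have "root n (norm (real n ^ 4 * \<gamma> ^ n)) = root n (real n ^ 4) * root n (\<gamma> ^ n)"
        by (simp only: real_root_mult)
      also have "root n (real n ^ 4) = root n (real n) ^ 4" using elim by (rule real_root_power)
      also have "root n (\<gamma> ^ n) = \<gamma>" using elim assms by (intro real_root_power_cancel) auto
      finally show ?case by (rule sym)
    qed
  qed
qed (use assms in simp)

text \<open>Intended for tour lengths. The event \<open>L x = n\<close> lies in the tail beyond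
  \<open>n - 1\<close>, which costs a factor \<open>1 / \<gamma>\<close>; the value
  \<open>n = 0\<close> contributes nothing to a fourth moment.\<close>

lemma integrable_power4_geometric_tail:
  fixes p :: "'a pmf" and L :: "'a \<Rightarrow> nat"
  assumes \<gamma>: "0 < \<gamma>" "\<gamma> < 1" and tail: "\<And>n. measure_pmf.prob p {x. L x > n} \<le> C * \<gamma> ^ n"
  shows "integrable (measure_pmf p) (\<lambda>x. real (L x) ^ 4)"
proof (rule integrableI_bounded)
  have C0: "0 \<le> C" using order_trans[OF measure_nonneg tail[of 0]] by simp
  have pt: "pmf (map_pmf L p) n \<le> C / \<gamma> * \<gamma> ^ n" if "n > 0" for n
  proof -
    have "pmf (map_pmf L p) n = measure_pmf.prob p {x. L x = n}"
      by (simp add: pmf_map vimage_def)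
    also have "\<dots> \<le> measure_pmf.prob p {x. L x > n - 1}"
      using that by (intro measure_pmf.finite_measure_mono) auto
    also have "\<dots> \<le> C * \<gamma> ^ (n - 1)" by (rule tail)
    also have "\<dots> = C / \<gamma> * \<gamma> ^ n" using that \<gamma> by (cases n) auto
    finally show ?thesis .
  qed
  have summ: "summable (\<lambda>n. C / \<gamma> * (real n ^ 4 * \<gamma> ^ n))"
    by (intro summable_mult summable_power4_geometric \<gamma>)
  have "(\<integral>\<^sup>+x. ennreal (norm (real (L x) ^ 4)) \<partial>measure_pmf p)
      = (\<integral>\<^sup>+n. ennreal (real n ^ 4) \<partial>measure_pmf (map_pmf L p))" by simp
  also have "\<dots> = (\<Sum>n. ennreal (pmf (map_pmf L p) n * real n ^ 4))"
    by (simp add: nn_integral_measure_pmf nn_integral_count_space_nat ennreal_mult)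
  also have "\<dots> \<le> (\<Sum>n. ennreal (C / \<gamma> * (real n ^ 4 * \<gamma> ^ n)))"
  proof (intro suminf_le summableI ennreal_leI)
    fix n :: nat
    show "pmf (map_pmf L p) n * real n ^ 4 \<le> C / \<gamma> * (real n ^ 4 * \<gamma> ^ n)"
    proof (cases "n = 0")
      case False
      then have "pmf (map_pmf L p) n * real n ^ 4 \<le> (C / \<gamma> * \<gamma> ^ n) * real n ^ 4"
        using pt by (intro mult_right_mono) auto
      then show ?thesis by (simp add: mult_ac)
    qed simp
  qed
  also have "\<dots> = ennreal (\<Sum>n. C / \<gamma> * (real n ^ 4 * \<gamma> ^ n))"
    using summ C0 \<gamma> by (intro suminf_ennreal2) auto
  also have "\<dots> < \<infinity>" by simp
  finally show "(\<integral>\<^sup>+x. ennreal (norm (real (L x) ^ 4)) \<partial>measure_pmf p) < \<infinity>" .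
qed simp

text \<open>By Tonelli the series of all \<open>W n\<close> has finite expectation, so it converges
  almost surely and its terms vanish. The joint law of different \<open>W n\<close> does not
  enter.\<close>

lemma AE_tendsto_0_if_summable_nn_integral:
  fixes W :: "nat \<Rightarrow> 'a \<Rightarrow> real"
  assumes meas[measurable]: "\<And>n. W n \<in> borel_measurable M"
    and nonneg: "\<And>n x. 0 \<le> W n x"
    and bound: "\<And>n. (\<integral>\<^sup>+x. W n x \<partial>M) \<le> ennreal (c n)"
    and c: "summable c" "\<And>n. 0 \<le> c n"
  shows "AE x in M. (\<lambda>n. W n x) \<longlonglongrightarrow> 0"
proof -
  have "(\<integral>\<^sup>+x. (\<Sum>n. ennreal (W n x)) \<partial>M) = (\<Sum>n. \<integral>\<^sup>+x. W n x \<partial>M)"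
    by (rule nn_integral_suminf) simp
  also have "\<dots> \<le> (\<Sum>n. ennreal (c n))"
    using bound by (intro suminf_le summableI) auto
  also have "\<dots> = ennreal (suminf c)" using c by (intro suminf_ennreal2) auto
  finally have "(\<integral>\<^sup>+x. (\<Sum>n. ennreal (W n x)) \<partial>M) \<noteq> \<infinity>"
    by (metis ennreal_neq_top infinity_ennreal_def neq_top_trans)
  then have "AE x in M. (\<Sum>n. ennreal (W n x)) \<noteq> \<infinity>"
    by (intro nn_integral_PInf_AE) auto
  then show ?thesis
  proof eventually_elim
    case (elim x)
    then have "summable (\<lambda>n. W n x)"
      using nonneg by (intro summable_suminf_not_top) auto
    then show ?case by (rule summable_LIMSEQ_zero)
  qed
qed

text \<open>The last inequality drives the moment recursion. It keeps \<open>a ^ 3 * b\<close>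
  exact, because orthogonality will remove it in expectation, and splits
  \<open>4 * (a * b ^ 3)\<close> evenly between \<open>a\<^sup>2 * b\<^sup>2\<close> and
  \<open>b ^ 4\<close>, which raises their coefficients from 6 and 1 to 8 and 3. The other bounds
  provide dominating functions and compare moments.\<close>

lemma abs_mult_power4_le:
  fixes a b :: real
  shows "\<bar>a * b\<bar> \<le> 1 + a ^ 4 + b ^ 4" "\<bar>a ^ 3 * b\<bar> \<le> a ^ 4 + b ^ 4" "a\<^sup>2 * b\<^sup>2 \<le> a ^ 4 + b ^ 4"
    "a\<^sup>2 \<le> 1 + a ^ 4" "(a + b) ^ 4 \<le> 8 * (a ^ 4 + b ^ 4)"
    "(a + b) ^ 4 \<le> a ^ 4 + 4 * (a ^ 3 * b) + 8 * (a\<^sup>2 * b\<^sup>2) + 3 * b ^ 4"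
proof -
  have sq: "2 * (x * y) \<le> x\<^sup>2 + y\<^sup>2" for x y :: real
    using zero_le_power2[of "x - y"] by (simp add: power2_eq_square algebra_simps)
  have p4: "x ^ 4 = (x\<^sup>2)\<^sup>2" for x :: real by simp
  have pos: "0 \<le> x ^ 4" "0 \<le> x\<^sup>2" for x :: real by simp_all
  have sq2: "2 * (a\<^sup>2 * b\<^sup>2) \<le> a ^ 4 + b ^ 4" unfolding p4 by (rule sq)
  then show "a\<^sup>2 * b\<^sup>2 \<le> a ^ 4 + b ^ 4" using pos[of a] pos[of b] by linarith
  have sq4: "2 * x\<^sup>2 \<le> 1 + x ^ 4" for x :: real
    using sq[of 1 "x\<^sup>2"] unfolding p4 by simp
  show "a\<^sup>2 \<le> 1 + a ^ 4" using sq4[of a] pos(1)[of a] by linarith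
  have abs: "2 * \<bar>a * b\<bar> \<le> a\<^sup>2 + b\<^sup>2" using sq[of "\<bar>a\<bar>" "\<bar>b\<bar>"] by (simp add: abs_mult)
  then show "\<bar>a * b\<bar> \<le> 1 + a ^ 4 + b ^ 4"
    using sq4[of a] sq4[of b] pos[of a] pos[of b] by linarith
  have "2 * \<bar>a ^ 3 * b\<bar> = a\<^sup>2 * (2 * \<bar>a * b\<bar>)"
    by (simp add: abs_mult power3_eq_cube power2_eq_square power_abs)
  also have "\<dots> \<le> a\<^sup>2 * (a\<^sup>2 + b\<^sup>2)" using abs by (intro mult_left_mono) auto
  also have "\<dots> = a ^ 4 + a\<^sup>2 * b\<^sup>2" by (simp add: field_simps power2_eq_square power4_eq_xxxx)
  finally show "\<bar>a ^ 3 * b\<bar> \<le> a ^ 4 + b ^ 4" using sq2 pos[of a] pos[of b] by linarith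
  have e: "(a + b) ^ 4 = a ^ 4 + 4 * (a ^ 3 * b) + 6 * (a\<^sup>2 * b\<^sup>2) + 4 * (a * b ^ 3) + b ^ 4"
    by (simp add: power4_eq_xxxx power3_eq_cube power2_eq_square algebra_simps)
  have f: "2 * (a * b ^ 3) \<le> a\<^sup>2 * b\<^sup>2 + b ^ 4" "2 * (a ^ 3 * b) \<le> a\<^sup>2 * b\<^sup>2 + a ^ 4"
    using mult_nonneg_nonneg[OF zero_le_power2[of b] zero_le_power2[of "a - b"]]
      mult_nonneg_nonneg[OF zero_le_power2[of a] zero_le_power2[of "a - b"]]
    by (simp_all add: power4_eq_xxxx power3_eq_cube power2_eq_square algebra_simps)
  show "(a + b) ^ 4 \<le> 8 * (a ^ 4 + b ^ 4)" using e f sq2 by argo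
  show "(a + b) ^ 4 \<le> a ^ 4 + 4 * (a ^ 3 * b) + 8 * (a\<^sup>2 * b\<^sup>2) + 3 * b ^ 4"
    using e f by argo
qed

context prob_space begin

lemma integrable_of_power4:
  assumes [measurable]: "f \<in> borel_measurable M" "g \<in> borel_measurable M"
    and f: "integrable M (\<lambda>\<omega>. (f \<omega> :: real) ^ 4)" and g: "integrable M (\<lambda>\<omega>. (g \<omega> :: real) ^ 4)"
  shows "integrable M (\<lambda>\<omega>. f \<omega> * g \<omega>)" "integrable M (\<lambda>\<omega>. f \<omega> ^ 3 * g \<omega>)"
    "integrable M (\<lambda>\<omega>. (f \<omega>)\<^sup>2 * (g \<omega>)\<^sup>2)" "integrable M (\<lambda>\<omega>. (f \<omega> + g \<omega>) ^ 4)"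
    "integrable M (\<lambda>\<omega>. (f \<omega>)\<^sup>2)"
proof -
  have fg: "integrable M (\<lambda>\<omega>. 8 * (1 + f \<omega> ^ 4 + g \<omega> ^ 4))"
    using f g by auto
  have *: "integrable M h" if "h \<in> borel_measurable M" "\<And>\<omega>. \<bar>h \<omega>\<bar> \<le> 8 * (1 + f \<omega> ^ 4 + g \<omega> ^ 4)"
    for h :: "'a \<Rightarrow> real"
    by (rule Bochner_Integration.integrable_bound[OF fg that(1)])
       (use order_trans[OF that(2) abs_ge_self] in auto)
  have pos: "0 \<le> x ^ 4" for x :: real by simp
  have dom: "\<bar>f \<omega> * g \<omega>\<bar> \<le> 8 * (1 + f \<omega> ^ 4 + g \<omega> ^ 4)" "\<bar>f \<omega> ^ 3 * g \<omega>\<bar> \<le> 8 * (1 + f \<omega> ^ 4 + g \<omega> ^ 4)"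
    "\<bar>(f \<omega>)\<^sup>2 * (g \<omega>)\<^sup>2\<bar> \<le> 8 * (1 + f \<omega> ^ 4 + g \<omega> ^ 4)"
    "\<bar>(f \<omega> + g \<omega>) ^ 4\<bar> \<le> 8 * (1 + f \<omega> ^ 4 + g \<omega> ^ 4)"
    "\<bar>(f \<omega>)\<^sup>2\<bar> \<le> 8 * (1 + f \<omega> ^ 4 + g \<omega> ^ 4)" for \<omega>
  proof -
    have abs: "\<bar>(f \<omega>)\<^sup>2 * (g \<omega>)\<^sup>2\<bar> = (f \<omega>)\<^sup>2 * (g \<omega>)\<^sup>2" "\<bar>(f \<omega> + g \<omega>) ^ 4\<bar> = (f \<omega> + g \<omega>) ^ 4"
      "\<bar>(f \<omega>)\<^sup>2\<bar> = (f \<omega>)\<^sup>2" by simp_all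
    show "\<bar>f \<omega> * g \<omega>\<bar> \<le> 8 * (1 + f \<omega> ^ 4 + g \<omega> ^ 4)" "\<bar>f \<omega> ^ 3 * g \<omega>\<bar> \<le> 8 * (1 + f \<omega> ^ 4 + g \<omega> ^ 4)"
      "\<bar>(f \<omega>)\<^sup>2 * (g \<omega>)\<^sup>2\<bar> \<le> 8 * (1 + f \<omega> ^ 4 + g \<omega> ^ 4)"
      "\<bar>(f \<omega> + g \<omega>) ^ 4\<bar> \<le> 8 * (1 + f \<omega> ^ 4 + g \<omega> ^ 4)"
      "\<bar>(f \<omega>)\<^sup>2\<bar> \<le> 8 * (1 + f \<omega> ^ 4 + g \<omega> ^ 4)"
      unfolding abs using abs_mult_power4_le(1-3,5)[of "f \<omega>" "g \<omega>"]
        abs_mult_power4_le(4)[of "f \<omega>"] pos[of "f \<omega>"] pos[of "g \<omega>"] by - argo+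
  qed
  show "integrable M (\<lambda>\<omega>. f \<omega> * g \<omega>)" "integrable M (\<lambda>\<omega>. f \<omega> ^ 3 * g \<omega>)"
    "integrable M (\<lambda>\<omega>. (f \<omega>)\<^sup>2 * (g \<omega>)\<^sup>2)" "integrable M (\<lambda>\<omega>. (f \<omega> + g \<omega>) ^ 4)"
    "integrable M (\<lambda>\<omega>. (f \<omega>)\<^sup>2)"
    by (intro * dom; measurable)+
qed

text \<open>The hypotheses are what centred independent variables and bounded martingale differences
  have in common. Since the second moment of \<open>S n\<close> grows at most linearly, step
  \<open>n\<close> adds at most \<open>8 * K\<^sup>2 * n + 3 * K\<^sup>2\<close>. The constant 11 is
  8 + 3, and \<open>11 * K\<^sup>2 * (2 * n + 1)\<close> is available.\<close>

lemma fourth_moment_partial_sums: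
  fixes D :: "nat \<Rightarrow> 'a \<Rightarrow> real"
  defines "S \<equiv> \<lambda>n \<omega>. \<Sum>i<n. D i \<omega>"
  assumes meas[measurable]: "\<And>n. D n \<in> borel_measurable M"
    and int4: "\<And>n. integrable M (\<lambda>\<omega>. D n \<omega> ^ 4)"
    and m2: "\<And>n. expectation (\<lambda>\<omega>. (D n \<omega>)\<^sup>2) \<le> K"
    and m4: "\<And>n. expectation (\<lambda>\<omega>. D n \<omega> ^ 4) \<le> K\<^sup>2"
    and orth1: "\<And>n. expectation (\<lambda>\<omega>. S n \<omega> * D n \<omega>) = 0"
    and orth3: "\<And>n. expectation (\<lambda>\<omega>. S n \<omega> ^ 3 * D n \<omega>) = 0"
    and cross: "\<And>n. expectation (\<lambda>\<omega>. (S n \<omega>)\<^sup>2 * (D n \<omega>)\<^sup>2) \<le> K * expectation (\<lambda>\<omega>. (S n \<omega>)\<^sup>2)"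
  shows "integrable M (\<lambda>\<omega>. S n \<omega> ^ 4)" "expectation (\<lambda>\<omega>. S n \<omega> ^ 4) \<le> 11 * K\<^sup>2 * (real n)\<^sup>2"
proof -
  have K0: "0 \<le> K" using m2[of 0] by (rule order_trans[rotated]) simp
  have [measurable]: "S n \<in> borel_measurable M" for n unfolding S_def by simp
  have S_Suc: "S (Suc n) = (\<lambda>\<omega>. S n \<omega> + D n \<omega>)" for n unfolding S_def by (simp add: add.commute)
  have S0: "S 0 = (\<lambda>_. 0)" unfolding S_def by simp
  show int: "integrable M (\<lambda>\<omega>. S n \<omega> ^ 4)" for n
    by (induction n) (auto simp: S0 S_Suc intro!: integrable_of_power4(4) int4)
  note I = integrable_of_power4[OF _ _ int int4]
  have int2: "integrable M (\<lambda>\<omega>. (S n \<omega>)\<^sup>2)" "integrable M (\<lambda>\<omega>. (D n \<omega>)\<^sup>2)" for n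
    by (auto intro!: integrable_of_power4(5)[OF _ _ _ int4] int int4)
  have E2: "expectation (\<lambda>\<omega>. (S n \<omega>)\<^sup>2) \<le> K * n" for n
  proof (induction n)
    case 0
    then show ?case by (simp add: S0)
  next
    case (Suc n)
    have "expectation (\<lambda>\<omega>. (S (Suc n) \<omega>)\<^sup>2)
        = expectation (\<lambda>\<omega>. (S n \<omega>)\<^sup>2 + 2 * (S n \<omega> * D n \<omega>) + (D n \<omega>)\<^sup>2)"
      unfolding S_Suc by (simp add: power2_sum add_ac mult_ac)
    also have "\<dots> = expectation (\<lambda>\<omega>. (S n \<omega>)\<^sup>2) + expectation (\<lambda>\<omega>. (D n \<omega>)\<^sup>2)"
      using int2 I(1) by (simp add: orth1)
    finally show ?case using Suc m2[of n] by (simp add: algebra_simps)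
  qed
  show "expectation (\<lambda>\<omega>. S n \<omega> ^ 4) \<le> 11 * K\<^sup>2 * (real n)\<^sup>2"
  proof (induction n)
    case 0
    then show ?case by (simp add: S0)
  next
    case (Suc n)
    have "expectation (\<lambda>\<omega>. S (Suc n) \<omega> ^ 4)
        \<le> expectation (\<lambda>\<omega>. S n \<omega> ^ 4 + 4 * (S n \<omega> ^ 3 * D n \<omega>) + 8 * ((S n \<omega>)\<^sup>2 * (D n \<omega>)\<^sup>2) + 3 * D n \<omega> ^ 4)"
      using int[of "Suc n"] I int int4 unfolding S_Suc
      by (intro integral_mono) (auto intro!: abs_mult_power4_le(6))
    also have "\<dots> = expectation (\<lambda>\<omega>. S n \<omega> ^ 4) + 8 * expectation (\<lambda>\<omega>. (S n \<omega>)\<^sup>2 * (D n \<omega>)\<^sup>2)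
        + 3 * expectation (\<lambda>\<omega>. D n \<omega> ^ 4)"
      using int I int4 by (simp add: orth3)
    also have "\<dots> \<le> 11 * K\<^sup>2 * (real n)\<^sup>2 + 8 * (K * (K * n)) + 3 * K\<^sup>2"
      using Suc order_trans[OF cross[of n] mult_left_mono[OF E2 K0]] m4[of n] by linarith
    also have "\<dots> \<le> 11 * K\<^sup>2 * (real (Suc n))\<^sup>2"
      using K0 by (simp add: power2_eq_square algebra_simps)
    finally show ?case .
  qed
qed

text \<open>\<open>S n\<close> involves only indices below \<open>n\<close>, so it is independent of
  \<open>D n\<close>. Every mixed moment factorises, and those linear in \<open>D n\<close> vanish
  with its mean.\<close>

lemma fourth_moment_iid:
  fixes D :: "nat \<Rightarrow> 'a \<Rightarrow> real"
  assumes indep: "indep_vars (\<lambda>_. borel) D UNIV"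
    and int4: "\<And>n. integrable M (\<lambda>\<omega>. D n \<omega> ^ 4)"
    and mean: "\<And>n. expectation (D n) = 0"
    and m2: "\<And>n. expectation (\<lambda>\<omega>. (D n \<omega>)\<^sup>2) \<le> K"
    and m4: "\<And>n. expectation (\<lambda>\<omega>. D n \<omega> ^ 4) \<le> K\<^sup>2"
  shows "integrable M (\<lambda>\<omega>. (\<Sum>i<n. D i \<omega>) ^ 4)"
    "expectation (\<lambda>\<omega>. (\<Sum>i<n. D i \<omega>) ^ 4) \<le> 11 * K\<^sup>2 * (real n)\<^sup>2"
proof -
  have meas[measurable]: "D n \<in> borel_measurable M" for n
    using indep unfolding indep_vars_def by auto
  define S where "S = (\<lambda>n \<omega>. \<Sum>i<n. D i \<omega>)"
  have measS[measurable]: "S n \<in> borel_measurable M" for n unfolding S_def by simp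
  have intS: "integrable M (\<lambda>\<omega>. S n \<omega> ^ 4)" for n
    by (induction n) (auto simp: S_def add.commute intro!: integrable_of_power4(4) int4)
  have ind: "indep_var borel (D n) borel (S n)" for n
    unfolding S_def by (rule indep_vars_sum) (auto intro: indep_vars_subset[OF indep])
  have lower: "integrable M f" "integrable M (\<lambda>\<omega>. f \<omega> ^ 3)" "integrable M (\<lambda>\<omega>. (f \<omega>)\<^sup>2)"
    if "f \<in> borel_measurable M" "integrable M (\<lambda>\<omega>. f \<omega> ^ 4)" for f :: "'a \<Rightarrow> real"
    using integrable_of_power4(1,2,5)[where f=f and g="\<lambda>_. 1"] that by simp_all
  note lowS = lower[OF measS intS] and lowD = lower[OF meas int4]
  have prod: "expectation (\<lambda>\<omega>. F (S n \<omega>) * G (D n \<omega>))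
      = expectation (\<lambda>\<omega>. F (S n \<omega>)) * expectation (\<lambda>\<omega>. G (D n \<omega>))"
    if "F \<in> borel_measurable borel" "G \<in> borel_measurable borel"
      "integrable M (\<lambda>\<omega>. F (S n \<omega>))" "integrable M (\<lambda>\<omega>. G (D n \<omega>))" for F G :: "real \<Rightarrow> real" and n
    using indep_var_lebesgue_integral[OF indep_var_compose[OF ind that(2,1)]] that(3,4)
    unfolding comp_def by (simp only: mult.commute)
  have orth1: "expectation (\<lambda>\<omega>. S n \<omega> * D n \<omega>) = 0" for n
    using prod[of "\<lambda>x. x" "\<lambda>x. x" n, OF _ _ lowS(1) lowD(1)] by (simp add: mean)
  have orth3: "expectation (\<lambda>\<omega>. S n \<omega> ^ 3 * D n \<omega>) = 0" for n
    by (subst prod[of "\<lambda>x. x ^ 3" "\<lambda>x. x" n, OF _ _ lowS(2) lowD(1)]) (simp_all only: mean mult_zero_right, measurable)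
  have cross: "expectation (\<lambda>\<omega>. (S n \<omega>)\<^sup>2 * (D n \<omega>)\<^sup>2) \<le> K * expectation (\<lambda>\<omega>. (S n \<omega>)\<^sup>2)" for n
  proof -
    have "expectation (\<lambda>\<omega>. (S n \<omega>)\<^sup>2 * (D n \<omega>)\<^sup>2)
        = expectation (\<lambda>\<omega>. (S n \<omega>)\<^sup>2) * expectation (\<lambda>\<omega>. (D n \<omega>)\<^sup>2)"
      by (rule prod[of "\<lambda>x. x\<^sup>2" "\<lambda>x. x\<^sup>2" n, OF _ _ lowS(3) lowD(3)]) measurable
    also have "\<dots> \<le> expectation (\<lambda>\<omega>. (S n \<omega>)\<^sup>2) * K"
      using m2 by (intro mult_left_mono) auto
    finally show ?thesis by (simp add: mult.commute)
  qed
  show "integrable M (\<lambda>\<omega>. (\<Sum>i<n. D i \<omega>) ^ 4)" using intS unfolding S_def .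
  show "expectation (\<lambda>\<omega>. (\<Sum>i<n. D i \<omega>) ^ 4) \<le> 11 * K\<^sup>2 * (real n)\<^sup>2"
    by (rule fourth_moment_partial_sums(2)[OF meas int4 m2 m4])
       (use orth1 orth3 cross in \<open>simp_all add: S_def\<close>)
qed

end

section \<open>Laws and independence recovered from point probabilities\<close>

text \<open>On an uncountable type point masses alone do not determine a measure. The support of
  \<open>p\<close> is countable, so \<open>N\<close> dominates \<open>c\<close> times
  \<open>p\<close> on every set; applying this to the complement and comparing total masses gives
  the reverse inequality.\<close>

lemma measure_eq_scaled_pmf:
  assumes N: "finite_measure N" "sets N = UNIV"
    and pt: "\<And>x. measure N {x} = c * pmf p x" and tot: "measure N UNIV = c"
  shows "measure N B = c * measure_pmf.prob p B"
proof -
  interpret finite_measure N by fact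
  have c0: "0 \<le> c" using tot by (metis measure_nonneg)
  have space: "space N = UNIV" using N(2) by (metis sets.top UNIV_I sets.sets_into_space top.extremum_uniqueI)
  have le: "c * measure_pmf.prob p B \<le> measure N B" for B
  proof -
    have "ennreal (c * measure_pmf.prob p B) = ennreal c * emeasure (measure_pmf p) (B \<inter> set_pmf p)"
      using c0 by (simp add: ennreal_mult measure_pmf.emeasure_eq_measure measure_Int_set_pmf)
    also have "\<dots> = ennreal c * (\<integral>\<^sup>+x. emeasure (measure_pmf p) {x} \<partial>count_space (B \<inter> set_pmf p))"
      by (subst emeasure_countable_singleton) auto
    also have "\<dots> = (\<integral>\<^sup>+x. emeasure N {x} \<partial>count_space (B \<inter> set_pmf p))"
      using c0 by (subst nn_integral_cmult[symmetric])
        (auto simp: emeasure_eq_measure pt emeasure_pmf_single ennreal_mult)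
    also have "\<dots> = emeasure N (B \<inter> set_pmf p)"
      using N(2) by (intro emeasure_countable_singleton[symmetric]) auto
    also have "\<dots> \<le> emeasure N B" using N(2) by (intro emeasure_mono) auto
    finally show ?thesis by (simp add: emeasure_eq_measure)
  qed
  have "measure N (- B) = c - measure N B"
    using finite_measure_compl[of B] N(2) by (simp add: space tot Compl_eq_Diff_UNIV)
  moreover have "measure_pmf.prob p (- B) = 1 - measure_pmf.prob p B"
    using measure_pmf.prob_compl[of B p] by (simp add: Compl_eq_Diff_UNIV)
  ultimately have "c - c * measure_pmf.prob p B \<le> c - measure N B"
    using le[of "- B"] by (simp only: right_diff_distrib mult_1_right)
  then show ?thesis using le[of B] by linarith
qed

context prob_space begin

text \<open>Interpolates between point events (\<open>K\<close> empty) and arbitrary events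
  (\<open>L\<close> empty). The induction frees one index at a time from its prescribed value, so
  \<open>L\<close> and \<tau> must stay general.\<close>

lemma iid_pmf_prob:
  fixes T :: "'i \<Rightarrow> 'a \<Rightarrow> 'b"
  assumes meas[measurable]: "\<And>r. T r \<in> M \<rightarrow>\<^sub>M count_space UNIV"
    and pt: "\<And>J \<tau>. finite J \<Longrightarrow> prob {\<omega> \<in> space M. \<forall>r\<in>J. T r \<omega> = \<tau> r} = (\<Prod>r\<in>J. pmf p (\<tau> r))"
    and fin: "finite K" "finite L" "K \<inter> L = {}"
  shows "prob {\<omega> \<in> space M. (\<forall>r\<in>K. T r \<omega> \<in> A r) \<and> (\<forall>r\<in>L. T r \<omega> = \<tau> r)}
    = (\<Prod>r\<in>K. measure_pmf.prob p (A r)) * (\<Prod>r\<in>L. pmf p (\<tau> r))"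
  using fin
proof (induction K arbitrary: L \<tau>)
  case empty
  then show ?case using pt by simp
next
  case (insert k K)
  define E where "E = {\<omega> \<in> space M. (\<forall>r\<in>K. T r \<omega> \<in> A r) \<and> (\<forall>r\<in>L. T r \<omega> = \<tau> r)}"
  have ev: "{\<omega> \<in> space M. T r \<omega> \<in> B} \<in> sets M" for r B
    using measurable_sets[OF meas[of r], of B] by (simp add: vimage_def Int_def conj_commute)
  have [measurable]: "E \<in> sets M"
    unfolding E_def using insert ev[of _ "{\<tau> _}"]
    by (intro sets.sets_Collect_conj sets.sets_Collect_finite_All ev) auto
  \<comment> \<open>The law of \<open>T k\<close> restricted to the event \<open>E\<close> about the
    other indices. Its total mass is the probability of \<open>E\<close>, not 1, hence the scaled
    comparison with \<open>p\<close>.\<close>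
  define N where "N = distr (density M (indicator E)) (count_space UNIV) (T k)"
  have N: "measure N B = prob {\<omega> \<in> E. T k \<omega> \<in> B}" for B
  proof -
    have "T k -` B \<inter> space M \<in> sets M" using measurable_sets[OF meas[of k], of B] by simp
    then have "emeasure N B = emeasure M (E \<inter> (T k -` B \<inter> space M))"
      unfolding N_def by (subst emeasure_distr) (auto simp: emeasure_restricted)
    also have "E \<inter> (T k -` B \<inter> space M) = {\<omega> \<in> E. T k \<omega> \<in> B}"
      unfolding E_def by auto
    finally show ?thesis by (simp add: measure_def)
  qed
  let ?c = "(\<Prod>r\<in>K. measure_pmf.prob p (A r)) * (\<Prod>r\<in>L. pmf p (\<tau> r))"
  have tot: "measure N UNIV = ?c"
    unfolding N using insert.IH[of L \<tau>] insert.prems by (simp add: E_def)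
  \<comment> \<open>Fixing \<open>T k\<close> at \<open>x\<close> moves \<open>k\<close> into
    \<open>L\<close>, where the induction hypothesis applies.\<close>
  have sing: "measure N {x} = ?c * pmf p x" for x
  proof -
    have "{\<omega> \<in> E. T k \<omega> \<in> {x}} = {\<omega> \<in> space M. (\<forall>r\<in>K. T r \<omega> \<in> A r)
        \<and> (\<forall>r\<in>insert k L. T r \<omega> = (\<tau>(k := x)) r)}"
      using insert unfolding E_def by auto
    moreover have "(\<Prod>r\<in>L. pmf p ((\<tau>(k := x)) r)) = (\<Prod>r\<in>L. pmf p (\<tau> r))"
      using insert by (intro prod.cong) auto
    ultimately show ?thesis
      unfolding N using insert.hyps insert.prems insert.IH[of "insert k L" "\<tau>(k := x)"]
      by (simp add: mult_ac)
  qed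
  have "finite_measure N" unfolding N_def
    by (intro finite_measure.finite_measure_distr finite_measure_restricted) auto
  then have "measure N (A k) = ?c * measure_pmf.prob p (A k)"
    by (intro measure_eq_scaled_pmf sing tot) (auto simp: N_def)
  moreover have "{\<omega> \<in> E. T k \<omega> \<in> A k} = {\<omega> \<in> space M. (\<forall>r\<in>insert k K. T r \<omega> \<in> A r)
        \<and> (\<forall>r\<in>L. T r \<omega> = \<tau> r)}"
    unfolding E_def by auto
  ultimately show ?case unfolding N using insert by (simp add: mult_ac)
qed

lemma
  fixes T :: "'i \<Rightarrow> 'a \<Rightarrow> 'b"
  assumes meas[measurable]: "\<And>r. T r \<in> M \<rightarrow>\<^sub>M count_space UNIV"
    and pt: "\<And>J \<tau>. finite J \<Longrightarrow> prob {\<omega> \<in> space M. \<forall>r\<in>J. T r \<omega> = \<tau> r} = (\<Prod>r\<in>J. pmf p (\<tau> r))"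
  shows distr_iid_pmf: "distr M (count_space UNIV) (T r) = measure_pmf p"
    and indep_vars_iid_pmf: "indep_vars (\<lambda>_. count_space UNIV) T UNIV"
proof -
  have joint: "prob {\<omega> \<in> space M. \<forall>r\<in>K. T r \<omega> \<in> A r} = (\<Prod>r\<in>K. measure_pmf.prob p (A r))"
    if "finite K" for K A
    using iid_pmf_prob[OF meas pt that finite.emptyI] by simp
  have marg: "prob (T r -` A \<inter> space M) = measure_pmf.prob p A" for r A
    using joint[of "{r}" "\<lambda>_. A"] by (simp add: vimage_def Int_def conj_commute)
  show "distr M (count_space UNIV) (T r) = measure_pmf p"
    by (rule measure_eqI) (simp_all add: emeasure_distr emeasure_eq_measure measure_pmf.emeasure_eq_measure marg)
  show "indep_vars (\<lambda>_. count_space UNIV) T UNIV"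
    unfolding indep_vars_def2
  proof (intro conjI ballI indep_setsI)
    fix A J assume J: "J \<noteq> {}" "J \<subseteq> (UNIV :: 'i set)" "finite J"
      and "\<forall>j\<in>J. A j \<in> {T j -` B \<inter> space M | B. B \<in> sets (count_space UNIV)}"
    then have "\<forall>j\<in>J. \<exists>B. A j = T j -` B \<inter> space M" by auto
    then obtain B where B: "\<And>j. j \<in> J \<Longrightarrow> A j = T j -` B j \<inter> space M" by metis
    have "(\<Inter>j\<in>J. A j) = {\<omega> \<in> space M. \<forall>r\<in>J. T r \<omega> \<in> B r}" using B J(1) by auto
    then show "prob (\<Inter>j\<in>J. A j) = (\<Prod>j\<in>J. prob (A j))"
      using joint[OF J(3), of B] B by (simp add: marg cong: prod.cong)
  qed (auto intro: measurable_sets[OF meas])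
qed

end

section \<open>Ergodic theorem for the simple random walk\<close>

text \<open>Connectedness appears as the absence of proper nonempty vertex sets closed under
  neighbours, the form in which closed classes of the two killed chains are refuted.\<close>

locale finite_connected_graph =
  fixes H :: "'a pair_pre_digraph"
  assumes finite_verts: "finite (pverts H)"
    and verts_nonempty: "pverts H \<noteq> {}"
    and arcs_subset: "parcs H \<subseteq> pverts H \<times> pverts H"
    and arcs_sym: "(x, y) \<in> parcs H \<Longrightarrow> (y, x) \<in> parcs H"
    and nbrs_nonempty: "x \<in> pverts H \<Longrightarrow> nbrs H x \<noteq> {}"
    and irreducible: "A \<subseteq> pverts H \<Longrightarrow> A \<noteq> {} \<Longrightarrow> (\<And>x. x \<in> A \<Longrightarrow> nbrs H x \<subseteq> A) \<Longrightarrow> A = pverts H"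
begin

abbreviation "V \<equiv> pverts H"
abbreviation "deg x \<equiv> real (card (nbrs H x))"
abbreviation "vol \<equiv> \<Sum>x\<in>V. deg x"

lemma nbrs_subset: "nbrs H x \<subseteq> V"
  using arcs_subset by (auto simp: nbrs_def)

lemma finite_nbrs [simp]: "finite (nbrs H x)"
  using nbrs_subset finite_verts by (rule finite_subset)

lemma nbrs_sym: "y \<in> nbrs H x \<longleftrightarrow> x \<in> nbrs H y"
  using arcs_sym by (auto simp: nbrs_def)

lemma nbrs_in_verts: "y \<in> nbrs H x \<Longrightarrow> x \<in> V" "y \<in> nbrs H x \<Longrightarrow> y \<in> V"
  using arcs_subset by (auto simp: nbrs_def)

lemma deg_ge_1: "x \<in> V \<Longrightarrow> 1 \<le> deg x"
  using nbrs_nonempty[of x] by (simp add: Suc_le_eq card_gt_0_iff)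

lemma vol_pos: "0 < vol"
  using finite_verts verts_nonempty deg_ge_1 by (intro sum_pos) force+

lemma sum_nbrs_swap: "(\<Sum>x\<in>V. \<Sum>y\<in>nbrs H x. f x y) = (\<Sum>y\<in>V. \<Sum>x\<in>nbrs H y. f x y)"
proof -
  have "(\<Sum>x\<in>V. \<Sum>y\<in>nbrs H x. f x y) = (\<Sum>x\<in>V. \<Sum>y\<in>{y\<in>V. y \<in> nbrs H x}. f x y)"
    using nbrs_subset by (intro sum.cong refl arg_cong2[where f=sum]) auto
  also have "\<dots> = (\<Sum>y\<in>V. \<Sum>x\<in>{x\<in>V. y \<in> nbrs H x}. f x y)"
    by (rule sum.swap_restrict) (auto intro: finite_verts)
  also have "\<dots> = (\<Sum>y\<in>V. \<Sum>x\<in>nbrs H y. f x y)"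
    using nbrs_subset nbrs_sym by (intro sum.cong refl arg_cong2[where f=sum]) auto
  finally show ?thesis .
qed

lemma sum_mult_pmf_nbrs:
  assumes "x \<in> V"
  shows "(\<Sum>y\<in>V. f y * pmf (pmf_of_set (nbrs H x)) y) = (\<Sum>y\<in>nbrs H x. f y) / deg x"
proof -
  have "(\<Sum>y\<in>V. f y * pmf (pmf_of_set (nbrs H x)) y) = (\<Sum>y\<in>nbrs H x. f y * (1 / deg x))"
    using nbrs_nonempty[OF assms] nbrs_subset
    by (intro sum.mono_neutral_cong_right finite_verts) (auto simp: pmf_of_set)
  then show ?thesis by (simp add: sum_divide_distrib)
qed

text \<open>
  The walk killed at a vertex \<open>r\<close> is transient, and \<open>h\<close> sums \<open>\<phi>\<close> along it; the centring of \<open>\<phi>\<close> makes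
  the equation hold at \<open>r\<close> as well.
\<close>
lemma poisson_equation:
  assumes centred: "(\<Sum>x\<in>V. deg x * \<phi> x) = 0"
  obtains h where "\<And>x. x \<in> V \<Longrightarrow> h x = \<phi> x + (\<Sum>y\<in>nbrs H x. h y) / deg x"
proof -
  obtain r where r: "r \<in> V" using verts_nonempty by auto
  define Q where "Q x y = (if y \<in> nbrs H x - {r} then 1 / deg x else 0)" for x y
  have Qsum: "(\<Sum>y\<in>B. Q x y * f y) = (\<Sum>y\<in>(nbrs H x - {r}) \<inter> B. f y) / deg x"
    if "B \<subseteq> V" for x B f
  proof -
    have "(\<Sum>y\<in>B. Q x y * f y) = (\<Sum>y\<in>(nbrs H x - {r}) \<inter> B. 1 / deg x * f y)"
      using finite_subset[OF that finite_verts] unfolding Q_def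
      by (intro sum.mono_neutral_cong_right) auto
    then show ?thesis by (simp add: sum_divide_distrib)
  qed
  note Qsum1 = Qsum[where f="\<lambda>_. 1", simplified]
  interpret transient_kernel V Q
  proof
    fix B assume B: "B \<subseteq> V" "B \<noteq> {}"
    show "\<exists>a\<in>B. (\<Sum>b\<in>B. Q a b) \<noteq> 1"
    proof (rule ccontr)
      assume "\<not> (\<exists>a\<in>B. (\<Sum>b\<in>B. Q a b) \<noteq> 1)"
      \<comment> \<open>A row sum of 1 forces all neighbours of \<open>a\<close> into
        \<open>B\<close> and away from \<open>r\<close>. Irreducibility then makes \<open>B\<close>
        everything, yet a neighbour of \<open>r\<close> has \<open>r\<close> as a neighbour.\<close>
      then have full: "card ((nbrs H a - {r}) \<inter> B) = card (nbrs H a)" if "a \<in> B" for a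
        using that Qsum1[OF B(1), of a] deg_ge_1[of a] B(1) by (auto simp: field_simps)
      have "(nbrs H a - {r}) \<inter> B = nbrs H a" if "a \<in> B" for a
        by (rule card_subset_eq) (use full[OF that] in auto)
      then have sub: "nbrs H a \<subseteq> B - {r}" if "a \<in> B" for a using that by blast
      then have "B = V" using irreducible B by blast
      obtain z where "z \<in> nbrs H r" using nbrs_nonempty[OF r] by auto
      then have "r \<in> nbrs H z" "z \<in> B" using nbrs_sym nbrs_in_verts \<open>B = V\<close> by auto
      then show False using sub by blast
    qed
  next
    fix a assume a: "a \<in> V"
    have "card ((nbrs H a - {r}) \<inter> V) \<le> card (nbrs H a)" by (intro card_mono) auto
    then show "(\<Sum>b\<in>V. Q a b) \<le> 1" using deg_ge_1[OF a] by (simp add: Qsum1)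
  qed (auto simp: Q_def finite_verts)
  obtain h' where "\<And>a. a \<in> V \<Longrightarrow> h' a = \<phi> a + (\<Sum>b\<in>V. Q a b * h' b)"
    using resolvent_solution[of \<phi>] by blast
  then have h': "h' x = \<phi> x + (\<Sum>y\<in>nbrs H x - {r}. h' y) / deg x" if "x \<in> V" for x
  proof -
    have "(nbrs H x - {r}) \<inter> V = nbrs H x - {r}" using nbrs_subset by auto
    then show ?thesis using \<open>\<And>a. a \<in> V \<Longrightarrow> h' a = _\<close>[OF that] Qsum[of V x h'] by simp
  qed
  \<comment> \<open>With value 0 at \<open>r\<close> the killed sums become sums over all
    neighbours. The equation then holds for \<open>h\<close> once \<open>h' r = 0\<close> is
    known.\<close>
  define h where "h = h'(r := 0)"
  have h: "h' x = \<phi> x + (\<Sum>y\<in>nbrs H x. h y) / deg x" if "x \<in> V" for x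
  proof -
    have "(\<Sum>y\<in>nbrs H x - {r}. h' y) = (\<Sum>y\<in>nbrs H x. h y)"
      unfolding h_def by (intro sum.mono_neutral_cong_left) auto
    then show ?thesis using h'[OF that] by simp
  qed
  \<comment> \<open>Summing against the degrees, which are invariant for the walk, cancels every
    vertex where \<open>h\<close> and \<open>h'\<close> agree. Only \<open>deg r * h' r\<close> is
    left, and it must be 0.\<close>
  have "(\<Sum>x\<in>V. deg x * h' x) = (\<Sum>x\<in>V. deg x * \<phi> x) + (\<Sum>x\<in>V. \<Sum>y\<in>nbrs H x. h y)"
    unfolding sum.distrib[symmetric] using h deg_ge_1
    by (intro sum.cong refl) (force simp: field_simps)
  also have "\<dots> = (\<Sum>x\<in>V. deg x * h x)"
    by (subst sum_nbrs_swap) (simp add: centred)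
  finally have "(\<Sum>x\<in>V. deg x * (h' x - h x)) = 0"
    by (simp add: right_diff_distrib sum_subtractf)
  also have "(\<Sum>x\<in>V. deg x * (h' x - h x)) = (\<Sum>x\<in>{r}. deg x * (h' x - h x))"
    using r finite_verts by (intro sum.mono_neutral_right) (auto simp: h_def)
  finally have "h' r = 0" using deg_ge_1[OF r] by (auto simp: h_def)
  then have "h = h'" by (simp add: h_def fun_upd_idem)
  then show thesis using that h by blast
qed

end

section \<open>The martingale of the walk and its averages\<close>

locale graph_walk = finite_connected_graph H + prob_space M
  for H :: "'a pair_pre_digraph" and M :: "'w measure" +
  fixes X :: "nat \<Rightarrow> 'w \<Rightarrow> 'a"
  assumes walk: "simple_random_walk M H X"
begin

lemma measurable_walk [measurable]: "X n \<in> M \<rightarrow>\<^sub>M count_space V"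
  using walk unfolding simple_random_walk_def by blast

lemma walk_in_verts: "\<omega> \<in> space M \<Longrightarrow> X n \<omega> \<in> V"
  using measurable_space[OF measurable_walk] by simp

lemma measurable_comp_walk [measurable]: "(\<lambda>\<omega>. f (X n \<omega>)) \<in> M \<rightarrow>\<^sub>M borel"
  by (rule measurable_compose[OF measurable_walk]) simp

lemma sets_walk_eq [measurable]: "{\<omega> \<in> space M. X n \<omega> = x} \<in> sets M"
proof (cases "x \<in> V")
  case True
  have "{\<omega> \<in> space M. X n \<omega> = x} = X n -` {x} \<inter> space M" by auto
  then show ?thesis using measurable_sets[OF measurable_walk, of "{x}" n] True by simp
next
  case False
  then have "{\<omega> \<in> space M. X n \<omega> = x} = {}" using walk_in_verts by auto
  then show ?thesis by (simp only: sets.empty_sets)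
qed

text \<open>The product form also covers histories of probability 0, for which the conditional law
  says nothing; all histories can then be summed alike.\<close>

lemma prob_walk_Suc:
  "prob {\<omega> \<in> space M. (\<forall>i\<le>n. X i \<omega> = x i) \<and> X (Suc n) \<omega> = y}
    = prob {\<omega> \<in> space M. \<forall>i\<le>n. X i \<omega> = x i} * pmf (pmf_of_set (nbrs H (x n))) y"
proof (cases "prob {\<omega> \<in> space M. \<forall>i\<le>n. X i \<omega> = x i} = 0")
  case True
  have "prob {\<omega> \<in> space M. (\<forall>i\<le>n. X i \<omega> = x i) \<and> X (Suc n) \<omega> = y}
      \<le> prob {\<omega> \<in> space M. \<forall>i\<le>n. X i \<omega> = x i}"
    by (intro finite_measure_mono) auto
  then show ?thesis using True by (simp add: measure_le_0_iff)
next
  case False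
  then have pos: "prob {\<omega> \<in> space M. \<forall>i\<le>n. X i \<omega> = x i} > 0"
    by (simp add: zero_less_measure_iff)
  with walk have "\<P>(\<omega> in M. X (Suc n) \<omega> = y \<bar> \<forall>i\<le>n. X i \<omega> = x i) = pmf (pmf_of_set (nbrs H (x n))) y"
    unfolding simple_random_walk_def by blast
  with pos show ?thesis unfolding cond_prob_def by (simp add: field_simps conj_commute)
qed

text \<open>The martingale difference property: the hypothesis makes \<open>F\<close> depend on the
  path up to time \<open>n\<close> only, and the subtracted average is the one-step prediction of
  \<open>h\<close>. Finitely many histories make this a finite sum.\<close>

lemma expectation_walk_increment:
  fixes F :: "(nat \<Rightarrow> 'a) \<Rightarrow> real" and h :: "'a \<Rightarrow> real"
  assumes F: "\<And>x y. (\<And>i. i \<le> n \<Longrightarrow> x i = y i) \<Longrightarrow> F x = F y"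
  shows "expectation (\<lambda>\<omega>. F (\<lambda>i. X i \<omega>) * (h (X (Suc n) \<omega>) - (\<Sum>y\<in>nbrs H (X n \<omega>). h y) / deg (X n \<omega>))) = 0"
    (is "expectation ?f = 0")
proof -
  \<comment> \<open>Histories are taken as extensional functions on \<open>{..n}\<close>, so that
    each outcome matches exactly one of them.\<close>
  define P where "P = PiE {..n} (\<lambda>_. V)"
  have finP: "finite P" unfolding P_def by (intro finite_PiE finite_verts) auto
  define a where "a x = (\<Sum>y\<in>nbrs H (x n). h y) / deg (x n)" for x :: "nat \<Rightarrow> 'a"
  define E where "E x y = {\<omega> \<in> space M. (\<forall>i\<le>n. X i \<omega> = x i) \<and> X (Suc n) \<omega> = y}" for x y
  have [measurable]: "E x y \<in> sets M" for x y
  proof -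
    have "E x y = (\<Inter>i\<in>{..n}. {\<omega> \<in> space M. X i \<omega> = x i}) \<inter> {\<omega> \<in> space M. X (Suc n) \<omega> = y}"
      unfolding E_def by auto
    also have "\<dots> \<in> sets M" by (intro sets.Int sets.finite_INT sets_walk_eq) auto
    finally show ?thesis .
  qed
  have "expectation ?f = expectation (\<lambda>\<omega>. \<Sum>x\<in>P. \<Sum>y\<in>V. F x * (h y - a x) * indicator (E x y) \<omega>)"
  proof (rule Bochner_Integration.integral_cong)
    fix \<omega> assume \<omega>: "\<omega> \<in> space M"
    define x0 where "x0 = restrict (\<lambda>i. X i \<omega>) {..n}"
    have x0: "x0 \<in> P" unfolding x0_def P_def using walk_in_verts[OF \<omega>] by auto
    have eq: "\<omega> \<in> E x y \<longleftrightarrow> x = x0 \<and> y = X (Suc n) \<omega>" if "x \<in> P" for x y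
    proof
      assume "\<omega> \<in> E x y"
      then show "x = x0 \<and> y = X (Suc n) \<omega>"
        using that unfolding E_def x0_def P_def by (auto simp: PiE_def extensional_def restrict_def fun_eq_iff)
    next
      assume "x = x0 \<and> y = X (Suc n) \<omega>"
      then show "\<omega> \<in> E x y" using \<omega> unfolding E_def x0_def by auto
    qed
    have "(\<Sum>x\<in>P. \<Sum>y\<in>V. F x * (h y - a x) * indicator (E x y) \<omega>)
        = (\<Sum>x\<in>P. \<Sum>y\<in>V. if y = X (Suc n) \<omega> then (if x = x0 then F x * (h y - a x) else 0) else 0)"
      using eq by (intro sum.cong refl) (simp add: indicator_def)
    also have "\<dots> = F x0 * (h (X (Suc n) \<omega>) - a x0)"
      using x0 finP finite_verts walk_in_verts[OF \<omega>] by simp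
    also have "F x0 = F (\<lambda>i. X i \<omega>)" by (rule F) (simp add: x0_def)
    finally show "?f \<omega> = (\<Sum>x\<in>P. \<Sum>y\<in>V. F x * (h y - a x) * indicator (E x y) \<omega>)"
      by (simp add: a_def x0_def)
  qed simp
  also have "\<dots> = (\<Sum>x\<in>P. \<Sum>y\<in>V. F x * (h y - a x) * prob (E x y))"
    by (subst Bochner_Integration.integral_sum | intro Bochner_Integration.integrable_sum integrable_mult_right
      | simp add: emeasure_eq_measure)+
  also have "\<dots> = (\<Sum>x\<in>P. F x * prob {\<omega> \<in> space M. \<forall>i\<le>n. X i \<omega> = x i}
      * (\<Sum>y\<in>V. (h y - a x) * pmf (pmf_of_set (nbrs H (x n))) y))"
    unfolding E_def prob_walk_Suc sum_distrib_left by (intro sum.cong refl) (simp only: mult_ac)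
  also have "\<dots> = 0"
  proof (intro sum.neutral ballI)
    fix x assume "x \<in> P"
    then have xn: "x n \<in> V" unfolding P_def by auto
    have "(\<Sum>y\<in>V. (h y - a x) * pmf (pmf_of_set (nbrs H (x n))) y) = 0"
      unfolding sum_mult_pmf_nbrs[OF xn]
      using deg_ge_1[OF xn] by (auto simp: a_def sum_subtractf)
    then show "F x * prob {\<omega> \<in> space M. \<forall>i\<le>n. X i \<omega> = x i}
      * (\<Sum>y\<in>V. (h y - a x) * pmf (pmf_of_set (nbrs H (x n))) y) = 0" by simp
  qed
  finally show ?thesis .
qed

text \<open>Poisson's equation writes the sum of \<phi> along the walk as a martingale with bounded
  increments plus two boundary values of a bounded function. The fourth moment of the martingale
  divided by \<open>n\<close> is summable.\<close>

lemma ergodic_centred: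
  fixes \<phi> :: "'a \<Rightarrow> real"
  assumes centred: "(\<Sum>x\<in>V. deg x * \<phi> x) = 0"
  shows "AE \<omega> in M. (\<lambda>t. (\<Sum>i<t. \<phi> (X i \<omega>)) / real t) \<longlonglongrightarrow> 0"
proof -
  obtain h where h: "\<And>x. x \<in> V \<Longrightarrow> h x = \<phi> x + (\<Sum>y\<in>nbrs H x. h y) / deg x"
    using poisson_equation[OF centred] by blast
  \<comment> \<open>This form telescopes. On the space, Poisson's equation turns it into
    \<open>h\<close> at the next state minus its predicted value, which is the form that is
    orthogonal to the past.\<close>
  define D where "D n \<omega> = h (X (Suc n) \<omega>) - h (X n \<omega>) + \<phi> (X n \<omega>)" for n \<omega>
  have D: "D n \<omega> = h (X (Suc n) \<omega>) - (\<Sum>y\<in>nbrs H (X n \<omega>). h y) / deg (X n \<omega>)"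
    if "\<omega> \<in> space M" for n \<omega>
    using h[OF walk_in_verts[OF that, of n]] unfolding D_def by simp
  have [measurable]: "D n \<in> borel_measurable M" for n unfolding D_def by measurable
  obtain A where A: "\<And>x. x \<in> V \<Longrightarrow> \<bar>h x\<bar> \<le> A"
    using finite_verts by (metis Max_ge finite_imageI imageI)
  obtain A' where A': "\<And>x. x \<in> V \<Longrightarrow> \<bar>\<phi> x\<bar> \<le> A'"
    using finite_verts by (metis Max_ge finite_imageI imageI)
  define B where "B = 2 * A + A'"
  have DB: "\<bar>D n \<omega>\<bar> \<le> B" if "\<omega> \<in> space M" for n \<omega>
    using A[OF walk_in_verts[OF that, of "Suc n"]] A[OF walk_in_verts[OF that, of n]]
      A'[OF walk_in_verts[OF that, of n]] unfolding D_def B_def by linarith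
  define K where "K = B\<^sup>2"
  have D2: "(D n \<omega>)\<^sup>2 \<le> K" and D4: "D n \<omega> ^ 4 \<le> K\<^sup>2" if "\<omega> \<in> space M" for n \<omega>
  proof -
    show 1: "(D n \<omega>)\<^sup>2 \<le> K" using DB[OF that, of n] unfolding K_def by (metis abs_ge_zero power2_abs power_mono)
    have "D n \<omega> ^ 4 = ((D n \<omega>)\<^sup>2)\<^sup>2" by simp
    also have "\<dots> \<le> K\<^sup>2" using 1 by (intro power_mono) auto
    finally show "D n \<omega> ^ 4 \<le> K\<^sup>2" .
  qed
  have int4: "integrable M (\<lambda>\<omega>. D n \<omega> ^ 4)" for n
    by (rule integrable_const_bound[where B="K\<^sup>2"]) (auto intro!: AE_I2 D4 simp: power_even_abs)
  have int2: "integrable M (\<lambda>\<omega>. (D n \<omega>)\<^sup>2)" for n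
    by (rule integrable_const_bound[where B="K"]) (auto intro!: AE_I2 D2)
  have m4: "expectation (\<lambda>\<omega>. D n \<omega> ^ 4) \<le> K\<^sup>2" for n
    using integral_mono[OF int4 integrable_const D4] by (simp add: prob_space)
  have m2: "expectation (\<lambda>\<omega>. (D n \<omega>)\<^sup>2) \<le> K" for n
    using integral_mono[OF int2 integrable_const D2] by (simp add: prob_space)
  define S where "S n \<omega> = (\<Sum>i<n. D i \<omega>)" for n \<omega>
  have [measurable]: "S n \<in> borel_measurable M" for n unfolding S_def by measurable
  have orth: "expectation (\<lambda>\<omega>. S n \<omega> ^ j * D n \<omega>) = 0" for n j
  proof -
    \<comment> \<open>\<open>S n\<close> is displayed as a function of the path up to time
      \<open>n\<close>; its last summand reads index \<open>Suc (n - 1)\<close>, still within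
      range.\<close>
    have "expectation (\<lambda>\<omega>. S n \<omega> ^ j * D n \<omega>)
      = expectation (\<lambda>\<omega>. (\<lambda>x. (\<Sum>i<n. h (x (Suc i)) - h (x i) + \<phi> (x i)) ^ j) (\<lambda>i. X i \<omega>)
          * (h (X (Suc n) \<omega>) - (\<Sum>y\<in>nbrs H (X n \<omega>). h y) / deg (X n \<omega>)))"
      by (rule Bochner_Integration.integral_cong) (simp_all add: S_def D flip: D_def)
    also have "\<dots> = 0"
      by (rule expectation_walk_increment) (auto intro!: arg_cong[where f="\<lambda>x. x ^ j"] sum.cong)
    finally show ?thesis .
  qed
  have intS: "integrable M (\<lambda>\<omega>. S n \<omega> ^ 4)" for n
    by (induction n) (auto simp: S_def add.commute intro!: integrable_of_power4(4) int4)
  have cross: "expectation (\<lambda>\<omega>. (S n \<omega>)\<^sup>2 * (D n \<omega>)\<^sup>2) \<le> K * expectation (\<lambda>\<omega>. (S n \<omega>)\<^sup>2)" for n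
  proof -
    have "expectation (\<lambda>\<omega>. (S n \<omega>)\<^sup>2 * (D n \<omega>)\<^sup>2) \<le> expectation (\<lambda>\<omega>. (S n \<omega>)\<^sup>2 * K)"
      using D2 by (intro integral_mono integrable_of_power4(3) integrable_mult_left integrable_of_power4(5)[OF _ _ _ int4]
        mult_left_mono intS int4) auto
    then show ?thesis by (simp add: mult.commute)
  qed
  have S4: "integrable M (\<lambda>\<omega>. S n \<omega> ^ 4)" "expectation (\<lambda>\<omega>. S n \<omega> ^ 4) \<le> 11 * K\<^sup>2 * (real n)\<^sup>2" for n
    using fourth_moment_partial_sums[of D K n] int4 m2 m4 orth[of _ 1] orth[of _ 3] cross
    by (auto simp: S_def)
  have "AE \<omega> in M. (\<lambda>n. (S n \<omega> / n) ^ 4) \<longlonglongrightarrow> 0"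
  proof (rule AE_tendsto_0_if_summable_nn_integral[where c="\<lambda>n. 11 * K\<^sup>2 * inverse (real n ^ 2)"])
    show "summable (\<lambda>n. 11 * K\<^sup>2 * inverse (real n ^ 2))"
      by (intro summable_mult inverse_power_summable) auto
    fix n :: nat
    have "(\<integral>\<^sup>+\<omega>. ennreal ((S n \<omega> / n) ^ 4) \<partial>M) = ennreal (expectation (\<lambda>\<omega>. S n \<omega> ^ 4) / real n ^ 4)"
      by (subst nn_integral_eq_integral) (auto simp: power_divide S4)
    also have "\<dots> \<le> ennreal (11 * K\<^sup>2 * inverse (real n ^ 2))"
    proof (intro ennreal_leI)
      have "expectation (\<lambda>\<omega>. S n \<omega> ^ 4) / real n ^ 4 \<le> 11 * K\<^sup>2 * (real n)\<^sup>2 / real n ^ 4"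
        using S4(2) by (intro divide_right_mono) auto
      also have "\<dots> = 11 * K\<^sup>2 * inverse (real n ^ 2)"
        by (cases "n = 0") (auto simp: field_simps power4_eq_xxxx power2_eq_square)
      finally show "expectation (\<lambda>\<omega>. S n \<omega> ^ 4) / real n ^ 4 \<le> 11 * K\<^sup>2 * inverse (real n ^ 2)" .
    qed
    finally show "(\<integral>\<^sup>+\<omega>. ennreal ((S n \<omega> / n) ^ 4) \<partial>M) \<le> ennreal (11 * K\<^sup>2 * inverse (real n ^ 2))" .
  qed auto
  then show ?thesis
  proof (rule AE_mp, intro AE_I2 impI)
    fix \<omega> assume \<omega>: "\<omega> \<in> space M" and "(\<lambda>n. (S n \<omega> / n) ^ 4) \<longlonglongrightarrow> 0"
    then have lim: "(\<lambda>n. S n \<omega> / n) \<longlonglongrightarrow> 0" by (simp add: power_tendsto_0_iff)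
    have tele: "S n \<omega> = h (X n \<omega>) - h (X 0 \<omega>) + (\<Sum>i<n. \<phi> (X i \<omega>))" for n
      unfolding S_def D_def by (induction n) auto
    have lim2: "(\<lambda>n. (h (X n \<omega>) - h (X 0 \<omega>)) / n) \<longlonglongrightarrow> 0"
    proof (rule Lim_null_comparison)
      show "\<forall>\<^sub>F n in sequentially. norm ((h (X n \<omega>) - h (X 0 \<omega>)) / real n) \<le> 2 * A / n"
      proof (intro always_eventually allI)
        fix n
        have "\<bar>h (X n \<omega>) - h (X 0 \<omega>)\<bar> \<le> 2 * A"
          using A[OF walk_in_verts[OF \<omega>, of n]] A[OF walk_in_verts[OF \<omega>, of 0]] by linarith
        then show "norm ((h (X n \<omega>) - h (X 0 \<omega>)) / real n) \<le> 2 * A / n"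
          by (simp add: divide_right_mono)
      qed
      show "(\<lambda>n. 2 * A / real n) \<longlonglongrightarrow> 0" by (rule lim_const_over_n)
    qed
    have "(\<lambda>n. (\<Sum>i<n. \<phi> (X i \<omega>)) / real n) = (\<lambda>n. S n \<omega> / n - (h (X n \<omega>) - h (X 0 \<omega>)) / n)"
      unfolding tele by (simp add: fun_eq_iff field_simps flip: add_divide_distrib diff_divide_distrib)
    then show "(\<lambda>n. (\<Sum>i<n. \<phi> (X i \<omega>)) / real n) \<longlonglongrightarrow> 0"
      using tendsto_diff[OF lim lim2] by simp
  qed
qed

theorem ergodic:
  fixes \<phi> :: "'a \<Rightarrow> real"
  shows "AE \<omega> in M. (\<lambda>t. (\<Sum>i<t. \<phi> (X i \<omega>)) / real t) \<longlonglongrightarrow> (\<Sum>x\<in>V. deg x * \<phi> x) / vol"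
proof -
  define m where "m = (\<Sum>x\<in>V. deg x * \<phi> x) / vol"
  have "(\<Sum>x\<in>V. deg x * (\<phi> x - m)) = (\<Sum>x\<in>V. deg x * \<phi> x) - vol * m"
    by (simp add: right_diff_distrib sum_subtractf sum_distrib_right)
  also have "\<dots> = 0" using vol_pos by (simp add: m_def)
  finally have "AE \<omega> in M. (\<lambda>t. (\<Sum>i<t. \<phi> (X i \<omega>) - m) / real t) \<longlonglongrightarrow> 0"
    by (rule ergodic_centred)
  then show ?thesis
  proof eventually_elim
    case (elim \<omega>)
    have "(\<lambda>t. (\<Sum>i<t. \<phi> (X i \<omega>) - m) / real t + m) \<longlonglongrightarrow> 0 + m"
      by (intro tendsto_add elim tendsto_const)
    moreover have "\<forall>\<^sub>F t in sequentially. (\<Sum>i<t. \<phi> (X i \<omega>) - m) / real t + m = (\<Sum>i<t. \<phi> (X i \<omega>)) / real t"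
      using eventually_gt_at_top[of 0]
      by eventually_elim (simp add: sum_subtractf diff_divide_distrib)
    ultimately show ?case unfolding m_def by (simp add: filterlim_cong)
  qed
qed

end

section \<open>Tours of the non-backtracking walk\<close>

lemma nn_integral_bind_pmf_finite:
  assumes "finite S" "set_pmf p \<subseteq> S"
  shows "(\<integral>\<^sup>+y. g y \<partial>bind_pmf p f) = (\<Sum>x\<in>S. ennreal (pmf p x) * (\<integral>\<^sup>+y. g y \<partial>f x))"
  unfolding nn_integral_bind_pmf
  by (subst nn_integral_measure_pmf_support[of S]) (use assms in \<open>auto simp: mult.commute\<close>)

lemma
  fixes g :: "'b \<Rightarrow> real"
  assumes S: "finite S" "set_pmf p \<subseteq> S" and int: "\<And>x. x \<in> S \<Longrightarrow> integrable (measure_pmf (f x)) g"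
  shows integrable_bind_pmf_finite: "integrable (measure_pmf (bind_pmf p f)) g"
    and integral_bind_pmf_finite:
      "measure_pmf.expectation (bind_pmf p f) g = (\<Sum>x\<in>S. pmf p x * measure_pmf.expectation (f x) g)"
proof -
  have fin: "(\<integral>\<^sup>+y. ennreal (norm (g y)) \<partial>f x) < \<infinity>" if "x \<in> S" for x
    using int[OF that] unfolding integrable_iff_bounded by blast
  show int': "integrable (measure_pmf (bind_pmf p f)) g"
  proof (rule integrableI_bounded)
    show "(\<integral>\<^sup>+y. ennreal (norm (g y)) \<partial>bind_pmf p f) < \<infinity>"
      unfolding nn_integral_bind_pmf_finite[OF S] using fin
      by (simp add: S(1) ennreal_mult_less_top)
  qed simp
  \<comment> \<open>Stated for any \<open>h\<close> below \<open>norm (g y)\<close> so that it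
    applies both to \<open>g\<close> and to \<open>- g\<close>, the two parts of the Lebesgue
    integral.\<close>
  have *: "enn2real (\<integral>\<^sup>+y. ennreal (h y) \<partial>bind_pmf p f) = (\<Sum>x\<in>S. pmf p x * enn2real (\<integral>\<^sup>+y. ennreal (h y) \<partial>f x))"
    if h: "\<And>y. h y \<le> norm (g y)" for h :: "'b \<Rightarrow> real"
  proof -
    have "(\<integral>\<^sup>+y. ennreal (h y) \<partial>f x) < \<infinity>" if "x \<in> S" for x
      using fin[OF that] by (rule le_less_trans[rotated]) (intro nn_integral_mono ennreal_leI h)
    then have "ennreal (pmf p x) * (\<integral>\<^sup>+y. ennreal (h y) \<partial>f x) < top" if "x \<in> S" for x
      using that by (simp add: ennreal_mult_less_top)
    then show ?thesis unfolding nn_integral_bind_pmf_finite[OF S]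
      by (subst enn2real_sum) (simp_all add: enn2real_mult)
  qed
  show "measure_pmf.expectation (bind_pmf p f) g = (\<Sum>x\<in>S. pmf p x * measure_pmf.expectation (f x) g)"
    unfolding real_lebesgue_integral_def[OF int'] using int
    by (subst (1 2) *) (simp_all add: real_lebesgue_integral_def sum_subtractf right_diff_distrib)
qed

context finite_connected_graph begin

lemma finite_arcs [simp]: "finite (parcs H)"
  using finite_subset[OF arcs_subset] finite_verts by blast

lemma arc_iff_nbrs: "(u, v) \<in> parcs H \<longleftrightarrow> v \<in> nbrs H u"
  by (simp add: nbrs_def)

lemma set_nrw_step:
  assumes "(u, v) \<in> parcs H"
  shows "set_pmf (nrw_step H u v) \<subseteq> nbrs H v"
proof (cases "card (nbrs H v) > 1")
  case True
  then have "\<not> nbrs H v \<subseteq> {u}" using card_mono[of "{u}" "nbrs H v"] by auto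
  then have "nbrs H v - {u} \<noteq> {}" by auto
  then show ?thesis using True by (auto simp: nrw_step_def)
next
  case False
  then show ?thesis using nbrs_nonempty[of v] assms arcs_subset by (auto simp: nrw_step_def)
qed

lemma sum_nrw_step:
  assumes "(u, v) \<in> parcs H"
  shows "(\<Sum>w\<in>nbrs H v. pmf (nrw_step H u v) w) = 1"
  using set_nrw_step[OF assms] by (intro sum_pmf_eq_1) auto

text \<open>This column identity is the source of double stochasticity. If \<open>v\<close> has
  \<open>d > 1\<close> neighbours, \<open>w\<close> is reached with probability
  \<open>1 / (d - 1)\<close> from each of the \<open>d - 1\<close> predecessors other than
  \<open>w\<close>; if \<open>d = 1\<close>, backtracking supplies the whole mass.\<close>

lemma sum_nrw_step_prev:
  assumes "(v, w) \<in> parcs H"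
  shows "(\<Sum>u\<in>nbrs H v. pmf (nrw_step H u v) w) = 1"
proof (cases "card (nbrs H v) > 1")
  case True
  have "(\<Sum>u\<in>nbrs H v. pmf (nrw_step H u v) w) = (\<Sum>u\<in>nbrs H v - {w}. 1 / real (card (nbrs H v) - 1))"
    using assms True by (intro sum.mono_neutral_cong_right) (auto simp: pmf_nrw_step arc_iff_nbrs)
  also have "\<dots> = 1" using assms True by (simp add: arc_iff_nbrs)
  finally show ?thesis .
next
  case False
  then have "card (nbrs H v) = 1" using assms card_gt_0_iff[of "nbrs H v"] by (auto simp: arc_iff_nbrs)
  then have "nbrs H v = {w}" using assms by (metis arc_iff_nbrs card_1_singletonE singletonD)
  then show ?thesis by (simp add: pmf_nrw_step)
qed

section \<open>The non-backtracking walk as a killed chain on arcs\<close>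

text \<open>Taking arcs (previous, current) as states makes the second-order walk first-order. Rows
  of arcs with head in \<open>I\<close> are zero, so arrival at \<open>I\<close> is the
  killing.\<close>

definition nrw_kernel :: "'a set \<Rightarrow> 'a \<times> 'a \<Rightarrow> 'a \<times> 'a \<Rightarrow> real" where
  "nrw_kernel I a b = (if snd a \<notin> I \<and> fst b = snd a then pmf (nrw_step H (fst a) (snd a)) (snd b) else 0)"

lemma sum_nrw_kernel:
  assumes "v \<notin> I"
  shows "(\<Sum>b\<in>parcs H. nrw_kernel I (u, v) b * f b) = (\<Sum>w\<in>nbrs H v. pmf (nrw_step H u v) w * f (v, w))"
proof -
  have "(\<Sum>b\<in>parcs H. nrw_kernel I (u, v) b * f b) = (\<Sum>b\<in>Pair v ` nbrs H v. pmf (nrw_step H u v) (snd b) * f b)"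
    using assms by (intro sum.mono_neutral_cong_right) (auto simp: nrw_kernel_def nbrs_def)
  also have "\<dots> = (\<Sum>w\<in>nbrs H v. pmf (nrw_step H u v) w * f (v, w))"
    by (subst sum.reindex) (auto simp: inj_on_def)
  finally show ?thesis .
qed

text \<open>An arc leaving \<open>I\<close> could be preceded only by an arc with head in
  \<open>I\<close>, where the chain is already killed; every other column is full.\<close>

lemma sum_nrw_kernel_col:
  assumes b: "b \<in> parcs H"
  shows "(\<Sum>a\<in>parcs H. nrw_kernel I a b) = (if fst b \<in> I then 0 else 1)"
proof (cases "fst b \<in> I")
  case True
  then show ?thesis by (auto simp: nrw_kernel_def intro!: sum.neutral)
next
  case False
  obtain v w where [simp]: "b = (v, w)" by (cases b)
  have "(\<Sum>a\<in>parcs H. nrw_kernel I a b) = (\<Sum>a\<in>(\<lambda>u. (u, v)) ` nbrs H v. pmf (nrw_step H (fst a) v) w)"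
    using False arcs_sym by (intro sum.mono_neutral_cong_right) (auto simp: nrw_kernel_def nbrs_def)
  also have "\<dots> = (\<Sum>u\<in>nbrs H v. pmf (nrw_step H u v) w)"
    by (subst sum.reindex) (auto simp: inj_on_def)
  finally show ?thesis using sum_nrw_step_prev[of v w] b False by simp
qed

text \<open>
  Without the supernode the kernel on arcs is doubly stochastic, so a closed set \<open>B\<close> of arcs is also
  closed under predecessors. Hence the heads of \<open>B\<close> are closed under adjacency and would exhaust the
  graph, including the supernode.
\<close>
lemma transient_nrw:
  assumes I: "I \<subseteq> V" "I \<noteq> {}"
  shows "transient_kernel (parcs H) (nrw_kernel I)"
proof -
  have row: "(\<Sum>b\<in>parcs H. nrw_kernel I a b) = 1" if "snd a \<notin> I" "a \<in> parcs H" for a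
    using sum_nrw_kernel[OF that(1), of "fst a" "\<lambda>_. 1"] sum_nrw_step[of "fst a" "snd a"] that by simp
  have row_le: "(\<Sum>b\<in>parcs H. nrw_kernel I a b) \<le> 1" if "a \<in> parcs H" for a
    using row[OF _ that] by (cases "snd a \<in> I") (auto simp: nrw_kernel_def)
  have nonneg: "0 \<le> nrw_kernel I a b" for a b by (simp add: nrw_kernel_def)
  have "\<exists>a\<in>B. (\<Sum>b\<in>B. nrw_kernel I a b) \<noteq> 1" if B: "B \<subseteq> parcs H" "B \<noteq> {}" for B
  proof (rule ccontr)
    have finB: "finite B" using B(1) finite_arcs by (rule finite_subset)
    assume "\<not> (\<exists>a\<in>B. (\<Sum>b\<in>B. nrw_kernel I a b) \<noteq> 1)"
    then have closed: "(\<Sum>b\<in>B. nrw_kernel I a b) = 1" if "a \<in> B" for a using that by blast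
    have head: "snd a \<notin> I" if "a \<in> B" for a
      using closed[OF that] by (auto simp: nrw_kernel_def)
    have succ: "nrw_kernel I a b = 0" if a: "a \<in> B" and b: "b \<in> parcs H - B" for a b
    proof -
      have "(\<Sum>b\<in>parcs H - B. nrw_kernel I a b) = 0"
        using sum.subset_diff[OF B(1) finite_arcs, of "nrw_kernel I a"] closed[OF a] row[OF head[OF a]] a B(1)
        by auto
      then show ?thesis using b nonneg by (subst (asm) sum_nonneg_eq_0_iff) auto
    qed
    have col_le: "(\<Sum>a\<in>B. nrw_kernel I a b) \<le> 1" if "b \<in> B" for b
    proof -
      have "(\<Sum>a\<in>B. nrw_kernel I a b) \<le> (\<Sum>a\<in>parcs H. nrw_kernel I a b)"
        using B(1) nonneg by (intro sum_mono2) auto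
      also have "\<dots> \<le> 1" using that B(1) sum_nrw_kernel_col[of b I] by auto
      finally show ?thesis .
    qed
    \<comment> \<open>Double counting: the rows of \<open>B\<close> carry total mass
      \<open>card B\<close> within \<open>B\<close>. As no column exceeds 1, every column within
      \<open>B\<close> must equal 1.\<close>
    have "(\<Sum>b\<in>B. 1 - (\<Sum>a\<in>B. nrw_kernel I a b)) = real (card B) - (\<Sum>a\<in>B. \<Sum>b\<in>B. nrw_kernel I a b)"
      unfolding sum_subtractf by (subst (2) sum.swap) simp
    also have "\<dots> = 0" using closed by simp
    finally have pred: "(\<Sum>a\<in>B. nrw_kernel I a b) = 1" if "b \<in> B" for b
      using col_le that finB by (subst (asm) sum_nonneg_eq_0_iff) auto
    have "snd ` B = V"
    proof (rule irreducible)
      show "snd ` B \<subseteq> V" using B(1) arcs_subset by auto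
      show "snd ` B \<noteq> {}" using B(2) by auto
      fix v assume "v \<in> snd ` B"
      then obtain u where uv: "(u, v) \<in> B" by auto
      show "nbrs H v \<subseteq> snd ` B"
      proof
        fix w assume w: "w \<in> nbrs H v"
        show "w \<in> snd ` B"
        proof (cases "w = u")
          \<comment> \<open>The vertex just left cannot in general be reached by a step from
            \<open>(u, v)\<close>. It is the head of a predecessor of this arc inside
            \<open>B\<close>.\<close>
          case True
          obtain a where a: "a \<in> B" "nrw_kernel I a (u, v) \<noteq> 0"
            using pred[OF uv] by (metis (no_types, lifting) sum.neutral zero_neq_one)
          then have "snd a = u" by (auto simp: nrw_kernel_def split: if_splits)
          then show ?thesis using a(1) True by (metis imageI)
        next
          case False
          have u: "u \<in> nbrs H v" using uv B(1) arcs_sym by (auto simp: nbrs_def)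
          have "card {u, w} \<le> card (nbrs H v)" using u w by (intro card_mono) auto
          then have "nrw_kernel I (u, v) (v, w) \<noteq> 0"
            using head[OF uv] False u w by (simp add: nrw_kernel_def pmf_nrw_step)
          then have "(v, w) \<in> B" using succ[OF uv, of "(v, w)"] w by (auto simp: arc_iff_nbrs)
          then show ?thesis by force
        qed
      qed
    qed
    then show False using head I by force
  qed
  then show ?thesis by unfold_locales (simp_all add: row_le nonneg)
qed

section \<open>Lengths and expected sums of tours\<close>

text \<open>Counting \<open>None\<close> as longer than any \<open>n\<close> lets one tail bound
  control both long paths and the mass of paths that never return.\<close>

definition nrw_tail :: "nat \<Rightarrow> 'a list option set" where
  "nrw_tail n = {z. case z of None \<Rightarrow> True | Some xs \<Rightarrow> n < length xs}"

lemma nrw_until_stop: "v \<in> I \<Longrightarrow> nrw_until H I u v = return_pmf (Some [v])"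
  by (subst nrw_until.simps) simp

lemma nrw_until_step:
  "v \<notin> I \<Longrightarrow> nrw_until H I u v =
     bind_pmf (nrw_step H u v) (\<lambda>w. map_pmf (map_option ((#) v)) (nrw_until H I v w))"
  by (subst nrw_until.simps) (simp add: bind_spmf_of_pmf)

text \<open>Removing the head of a path matches one application of the kernel: a path stopped at
  once has length 1 and meets a zero row, any other one passes to the next arc.\<close>

lemma nrw_tail_le_survival:
  assumes "(u, v) \<in> parcs H"
  shows "measure_pmf.prob (nrw_until H I u v) (nrw_tail n) \<le> survival (parcs H) (nrw_kernel I) n (u, v)"
  using assms
proof (induction n arbitrary: u v)
  case 0
  then show ?case by simp
next
  case (Suc n)
  show ?case
  proof (cases "v \<in> I")
    case True
    then have "measure_pmf.prob (nrw_until H I u v) (nrw_tail (Suc n)) = 0"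
      by (simp add: nrw_until_stop nrw_tail_def measure_pmf_zero_iff)
    then show ?thesis using True by (simp add: nrw_kernel_def)
  next
    case False
    have pre: "indicator (nrw_tail (Suc n)) (map_option ((#) v) z) = (indicator (nrw_tail n) z :: ennreal)" for z
      by (auto simp: nrw_tail_def indicator_def split: option.splits)
    have "ennreal (measure_pmf.prob (nrw_until H I u v) (nrw_tail (Suc n)))
      = (\<integral>\<^sup>+z. indicator (nrw_tail (Suc n)) z \<partial>nrw_until H I u v)"
      by (simp add: measure_pmf.emeasure_eq_measure)
    also have "\<dots> = (\<Sum>w\<in>nbrs H v. ennreal (pmf (nrw_step H u v) w) *
        ennreal (measure_pmf.prob (nrw_until H I v w) (nrw_tail n)))"
      unfolding nrw_until_step[OF False] nn_integral_bind_pmf_finite[OF finite_nbrs set_nrw_step[OF Suc.prems]]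
      by (simp add: pre measure_pmf.emeasure_eq_measure)
    also have "\<dots> = ennreal (\<Sum>w\<in>nbrs H v. pmf (nrw_step H u v) w * measure_pmf.prob (nrw_until H I v w) (nrw_tail n))"
      by (simp add: ennreal_mult flip: sum_ennreal)
    finally have "measure_pmf.prob (nrw_until H I u v) (nrw_tail (Suc n))
      = (\<Sum>w\<in>nbrs H v. pmf (nrw_step H u v) w * measure_pmf.prob (nrw_until H I v w) (nrw_tail n))"
      by (subst (asm) ennreal_inj) (auto intro!: sum_nonneg)
    also have "\<dots> \<le> (\<Sum>w\<in>nbrs H v. pmf (nrw_step H u v) w * survival (parcs H) (nrw_kernel I) n (v, w))"
      by (intro sum_mono mult_left_mono Suc.IH) (auto simp: arc_iff_nbrs)
    finally show ?thesis by (simp add: sum_nrw_kernel[OF False])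
  qed
qed

text \<open>Induction is on the path, since the recursion of the walk itself is not
  well-founded.\<close>

lemma set_nrw_until:
  assumes "Some xs \<in> set_pmf (nrw_until H I u v)" "(u, v) \<in> parcs H"
  shows "xs \<noteq> [] \<and> set xs \<subseteq> V"
  using assms
proof (induction xs arbitrary: u v)
  case Nil
  then show ?case by (cases "v \<in> I") (auto simp: nrw_until_stop nrw_until_step)
next
  case (Cons x xs)
  have "v \<in> V" using Cons.prems(2) arcs_subset by auto
  show ?case
  proof (cases "v \<in> I")
    case True
    then show ?thesis using Cons.prems \<open>v \<in> V\<close> by (simp add: nrw_until_stop)
  next
    case False
    then obtain w where "w \<in> nbrs H v" "x = v" "Some xs \<in> set_pmf (nrw_until H I v w)"
      using Cons.prems(1) set_nrw_step[OF Cons.prems(2)] by (auto simp: nrw_until_step)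
    then show ?thesis using Cons.IH[of v w] \<open>v \<in> V\<close> by (auto simp: arc_iff_nbrs)
  qed
qed

definition exits :: "'a set \<Rightarrow> ('a \<times> 'a) set" where
  "exits I = (SIGMA u:I. nbrs H u - I)"

text \<open>The continuation starts at the second vertex of a tour and ends with the vertex of
  return, so omitting its last entry leaves exactly the interior of the tour.\<close>

definition interior_sum :: "('a \<Rightarrow> real) \<Rightarrow> 'a list option \<Rightarrow> real" where
  "interior_sum \<phi> z = (case z of None \<Rightarrow> 0 | Some xs \<Rightarrow> \<Sum>j<length xs - 1. \<phi> (xs ! j))"

context
  fixes I :: "'a set"
  assumes I: "I \<subseteq> V" "I \<noteq> {}"
begin

interpretation nrw: transient_kernel "parcs H" "nrw_kernel I"
  by (rule transient_nrw) (rule I)+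

lemma nrw_tail_geometric:
  obtains C \<gamma> :: real where "0 < \<gamma>" "\<gamma> < 1"
    "\<forall>(u, v)\<in>parcs H. \<forall>n. measure_pmf.prob (nrw_until H I u v) (nrw_tail n) \<le> C * \<gamma> ^ n"
proof -
  obtain C \<gamma> where *: "0 < C" "0 < \<gamma>" "\<gamma> < 1"
    "\<And>a n. a \<in> parcs H \<Longrightarrow> survival (parcs H) (nrw_kernel I) n a \<le> C * \<gamma> ^ n"
    using nrw.survival_geometric by blast
  show thesis
    by (rule that[OF *(2,3)]) (auto intro: order_trans[OF nrw_tail_le_survival *(4)])
qed

text \<open>\<open>None\<close> belongs to every \<open>nrw_tail n\<close>, whose probabilities tend
  to 0.\<close>

lemma nrw_until_lossless:
  assumes "(u, v) \<in> parcs H"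
  shows "None \<notin> set_pmf (nrw_until H I u v)"
proof -
  obtain C \<gamma> where *: "0 < \<gamma>" "\<gamma> < 1"
    "\<forall>(u, v)\<in>parcs H. \<forall>n. measure_pmf.prob (nrw_until H I u v) (nrw_tail n) \<le> C * \<gamma> ^ n"
    by (rule nrw_tail_geometric)
  have tail: "measure_pmf.prob (nrw_until H I u v) (nrw_tail n) \<le> C * \<gamma> ^ n" for n
    using *(3) assms by blast
  have "pmf (nrw_until H I u v) None \<le> C * \<gamma> ^ n" for n
  proof -
    have "pmf (nrw_until H I u v) None = measure_pmf.prob (nrw_until H I u v) {None}"
      by (simp add: measure_pmf_single)
    also have "\<dots> \<le> measure_pmf.prob (nrw_until H I u v) (nrw_tail n)"
      by (intro measure_pmf.finite_measure_mono) (auto simp: nrw_tail_def)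
    finally show ?thesis using tail[of n] by linarith
  qed
  moreover have "(\<lambda>n. C * \<gamma> ^ n) \<longlonglongrightarrow> C * 0"
    using * by (intro tendsto_mult LIMSEQ_power_zero tendsto_const) auto
  ultimately have "pmf (nrw_until H I u v) None \<le> C * 0"
    by (intro LIMSEQ_le_const) auto
  then have "pmf (nrw_until H I u v) None = 0" using pmf_nonneg[of "nrw_until H I u v" None] by simp
  then show ?thesis by (simp add: set_pmf_iff)
qed

text \<open>On the finite vertex set \<phi> is bounded by some \<open>K\<close>, so the sum is at
  most \<open>K\<close> times the path length, which has a geometric tail.\<close>

lemma integrable_interior_sum:
  assumes "(u, v) \<in> parcs H"
  shows "integrable (nrw_until H I u v) (\<lambda>z. interior_sum \<phi> z ^ 4)"
    "integrable (nrw_until H I u v) (interior_sum \<phi>)"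
proof -
  let ?p = "nrw_until H I u v"
  obtain C \<gamma> where *: "0 < \<gamma>" "\<gamma> < 1"
    "\<forall>(u, v)\<in>parcs H. \<forall>n. measure_pmf.prob (nrw_until H I u v) (nrw_tail n) \<le> C * \<gamma> ^ n"
    by (rule nrw_tail_geometric)
  have tail: "measure_pmf.prob (nrw_until H I u v) (nrw_tail n) \<le> C * \<gamma> ^ n" for n
    using *(3) assms by blast
  define L where "L z = (case z of None \<Rightarrow> 0 | Some xs \<Rightarrow> length xs)" for z :: "'a list option"
  have "measure_pmf.prob ?p {z. L z > n} \<le> C * \<gamma> ^ n" for n
  proof -
    have "measure_pmf.prob ?p {z. L z > n} \<le> measure_pmf.prob ?p (nrw_tail n)"
      by (intro measure_pmf.finite_measure_mono) (auto simp: nrw_tail_def L_def split: option.splits)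
    then show ?thesis using tail[of n] by linarith
  qed
  then have intL: "integrable ?p (\<lambda>z. real (L z) ^ 4)"
    by (rule integrable_power4_geometric_tail[OF *(1,2)])
  obtain K where K: "\<And>x. x \<in> V \<Longrightarrow> \<bar>\<phi> x\<bar> \<le> K"
    using finite_verts by (metis Max_ge finite_imageI imageI)
  have K0: "0 \<le> K" using K verts_nonempty abs_ge_zero by (meson all_not_in_conv order_trans)
  have bound: "\<bar>interior_sum \<phi> z\<bar> \<le> K * real (L z)" if "z \<in> set_pmf ?p" for z
  proof (cases z)
    case None
    then show ?thesis by (simp add: interior_sum_def L_def)
  next
    case (Some xs)
    then have xs: "set xs \<subseteq> V" using set_nrw_until assms that by blast
    have "\<bar>interior_sum \<phi> z\<bar> \<le> (\<Sum>j<length xs - 1. \<bar>\<phi> (xs ! j)\<bar>)"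
      unfolding interior_sum_def Some by simp
    also have "\<dots> \<le> (\<Sum>j<length xs - 1. K)"
      using xs by (intro sum_mono K) (auto simp: subset_iff)
    also have "\<dots> \<le> K * real (L z)" using K0 by (simp add: L_def Some mult.commute mult_left_mono)
    finally show ?thesis .
  qed
  show int4: "integrable ?p (\<lambda>z. interior_sum \<phi> z ^ 4)"
  proof (rule Bochner_Integration.integrable_bound)
    show "integrable ?p (\<lambda>z. K ^ 4 * real (L z) ^ 4)" using intL by simp
    show "AE z in ?p. norm (interior_sum \<phi> z ^ 4) \<le> norm (K ^ 4 * real (L z) ^ 4)"
    proof (rule AE_pmfI)
      fix z assume "z \<in> set_pmf ?p"
      from power_mono[OF bound[OF this] abs_ge_zero, of 4]
      show "norm (interior_sum \<phi> z ^ 4) \<le> norm (K ^ 4 * real (L z) ^ 4)"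
        by (simp add: power_mult_distrib power_even_abs)
    qed
  qed simp
  have "integrable ?p (\<lambda>z. interior_sum \<phi> z * 1)"
    by (rule measure_pmf.integrable_of_power4(1)) (use int4 in simp_all)
  then show "integrable ?p (interior_sum \<phi>)" by simp
qed

abbreviation "expected_sum \<phi> u v \<equiv> measure_pmf.expectation (nrw_until H I u v) (interior_sum \<phi>)"

text \<open>First-step analysis: the current vertex contributes \<phi> once, and the rest is the sum
  along the continuation after the next step.\<close>

lemma expected_sum_step:
  assumes uv: "(u, v) \<in> parcs H" and v: "v \<notin> I"
  shows "expected_sum \<phi> u v = \<phi> v + (\<Sum>w\<in>nbrs H v. pmf (nrw_step H u v) w * expected_sum \<phi> v w)"
proof -
  \<comment> \<open>For \<open>None\<close> and for an empty path the left side would be 0 without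
    the term \<open>\<phi> v\<close>; both are excluded from the support.\<close>
  have eq: "AE z in nrw_until H I v w. interior_sum \<phi> (map_option ((#) v) z) = \<phi> v + interior_sum \<phi> z"
    if w: "(v, w) \<in> parcs H" for w
  proof (rule AE_pmfI)
    fix z assume z: "z \<in> set_pmf (nrw_until H I v w)"
    then obtain xs where xs: "z = Some xs" "xs \<noteq> []"
      using nrw_until_lossless[OF w] set_nrw_until[OF _ w] by (cases z) auto
    obtain n where n: "length xs = Suc n" using xs(2) by (cases xs) auto
    show "interior_sum \<phi> (map_option ((#) v) z) = \<phi> v + interior_sum \<phi> z"
      by (simp add: interior_sum_def xs(1) n sum.lessThan_Suc_shift del: sum.lessThan_Suc)
  qed
  have E: "measure_pmf.expectation (map_pmf (map_option ((#) v)) (nrw_until H I v w)) (interior_sum \<phi>)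
      = \<phi> v + expected_sum \<phi> v w" if w: "(v, w) \<in> parcs H" for w
  proof -
    have "measure_pmf.expectation (map_pmf (map_option ((#) v)) (nrw_until H I v w)) (interior_sum \<phi>)
      = measure_pmf.expectation (nrw_until H I v w) (\<lambda>z. \<phi> v + interior_sum \<phi> z)"
      unfolding integral_map_pmf by (rule integral_cong_AE) (use eq[OF w] in simp_all)
    also have "\<dots> = \<phi> v + expected_sum \<phi> v w"
      using integrable_interior_sum(2)[OF w] by simp
    finally show ?thesis .
  qed
  have int: "integrable (map_pmf (map_option ((#) v)) (nrw_until H I v w)) (interior_sum \<phi>)"
    if w: "(v, w) \<in> parcs H" for w
  proof -
    have "integrable (nrw_until H I v w) (\<lambda>z. interior_sum \<phi> (map_option ((#) v) z))
      \<longleftrightarrow> integrable (nrw_until H I v w) (\<lambda>z. \<phi> v + interior_sum \<phi> z)"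
      by (rule integrable_cong_AE) (use eq[OF w] in simp_all)
    then show ?thesis using integrable_interior_sum(2)[OF w] by (simp add: integrable_map_pmf_eq)
  qed
  have "expected_sum \<phi> u v = (\<Sum>w\<in>nbrs H v. pmf (nrw_step H u v) w * (\<phi> v + expected_sum \<phi> v w))"
    unfolding nrw_until_step[OF v]
    by (subst integral_bind_pmf_finite[OF finite_nbrs set_nrw_step[OF uv]])
       (auto simp: arc_iff_nbrs E int simp del: integral_map_pmf integrable_map_pmf_eq)
  also have "\<dots> = \<phi> v * (\<Sum>w\<in>nbrs H v. pmf (nrw_step H u v) w)
      + (\<Sum>w\<in>nbrs H v. pmf (nrw_step H u v) w * expected_sum \<phi> v w)"
    by (simp add: distrib_left sum.distrib sum_distrib_left mult.commute)
  finally show ?thesis using sum_nrw_step[OF uv] by simp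
qed

lemma expected_sum_stop: "v \<in> I \<Longrightarrow> expected_sum \<phi> u v = 0"
  by (simp add: nrw_until_stop interior_sum_def)

text \<open>
  Summing the one-step recursion over all arcs, double stochasticity cancels every arc whose tail is
  outside \<open>I\<close>.
\<close>
lemma expected_sum_boundary:
  "(\<Sum>u\<in>I. \<Sum>v\<in>nbrs H u - I. expected_sum \<phi> u v) = (\<Sum>v\<in>V - I. deg v * \<phi> v)"
proof -
  have finI: "finite I" using I finite_verts finite_subset by blast
  define T where "T v = (\<Sum>w\<in>nbrs H v. expected_sum \<phi> v w)" for v
  have inner: "(\<Sum>u\<in>nbrs H v. expected_sum \<phi> u v) = (if v \<in> I then 0 else deg v * \<phi> v + T v)" for v
  proof (cases "v \<in> I")
    case True
    then show ?thesis by (simp add: expected_sum_stop)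
  next
    case False
    have "(\<Sum>u\<in>nbrs H v. expected_sum \<phi> u v)
        = (\<Sum>u\<in>nbrs H v. \<phi> v + (\<Sum>w\<in>nbrs H v. pmf (nrw_step H u v) w * expected_sum \<phi> v w))"
      using False by (intro sum.cong refl expected_sum_step) (auto simp: arc_iff_nbrs nbrs_sym)
    also have "\<dots> = deg v * \<phi> v + (\<Sum>w\<in>nbrs H v. \<Sum>u\<in>nbrs H v. pmf (nrw_step H u v) w * expected_sum \<phi> v w)"
      unfolding sum.distrib by (subst sum.swap) simp
    also have "(\<Sum>w\<in>nbrs H v. \<Sum>u\<in>nbrs H v. pmf (nrw_step H u v) w * expected_sum \<phi> v w) = T v"
      unfolding T_def
      by (intro sum.cong refl) (simp add: sum_nrw_step_prev arc_iff_nbrs flip: sum_distrib_right)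
    finally show ?thesis using False by simp
  qed
  \<comment> \<open>The sum over all arcs is grouped by tails on the left and by heads on the right.
    The values of \<open>T\<close> outside \<open>I\<close> then cancel, leaving \<open>T\<close> on
    \<open>I\<close>.\<close>
  have "(\<Sum>v\<in>V. T v) = (\<Sum>v\<in>V. \<Sum>u\<in>nbrs H v. expected_sum \<phi> u v)"
    unfolding T_def by (rule sum_nbrs_swap)
  also have "\<dots> = (\<Sum>v\<in>V. if v \<in> I then 0 else deg v * \<phi> v + T v)" by (simp only: inner)
  also have "\<dots> = (\<Sum>v\<in>V - I. deg v * \<phi> v + T v)"
    using finite_verts by (intro sum.mono_neutral_cong_right) auto
  finally have "(\<Sum>v\<in>I. T v) = (\<Sum>v\<in>V - I. deg v * \<phi> v)"
    using sum.subset_diff[OF I(1) finite_verts, of T] by (simp add: sum.distrib)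
  \<comment> \<open>Arcs that end in \<open>I\<close> carry expected sum 0, so only possible first
    steps of a tour remain.\<close>
  moreover have "T u = (\<Sum>v\<in>nbrs H u - I. expected_sum \<phi> u v)" for u
    unfolding T_def by (intro sum.mono_neutral_right) (auto simp: expected_sum_stop)
  ultimately show ?thesis by simp
qed

lemma finite_exits [simp]: "finite (exits I)"
  by (rule finite_subset[OF _ finite_arcs]) (auto simp: exits_def arc_iff_nbrs)

lemma card_exits: "(\<Sum>s\<in>I. card (nbrs H s - I)) = card (exits I)"
  unfolding exits_def using finite_subset[OF I(1) finite_verts] by simp

lemma exits_empty_imp: "exits I = {} \<Longrightarrow> I = V"
  using irreducible[OF I] by (auto simp: exits_def)

lemma tour_law_exits:
  assumes "exits I \<noteq> {}"
  shows "tour_law H I = bind_pmf (pmf_of_set (exits I)) (\<lambda>(u, v). map_pmf (map_option ((#) u)) (nrw_until H I u v))"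
proof -
  have "{(u1, u2). u1 \<in> I \<and> u2 \<in> nbrs H u1 - I} = exits I" by (auto simp: exits_def)
  then show ?thesis
    unfolding tour_law_def using assms by (simp add: bind_spmf_of_pmf case_prod_unfold flip: spmf_of_pmf_pmf_of_set)
qed

lemma tour_sum_Cons:
  "tour_sum H R f s (map_option ((#) u) z)
    = interior_sum (\<lambda>x. f x * of_bool ((x, s) \<in> R) / deg x) z"
proof (cases z)
  case (Some xs)
  show ?thesis
  proof (cases xs)
    case (Cons y ys)
    have "{1..<Suc (length ys)} = Suc ` {..<length ys}"
      by (simp add: image_Suc_lessThan atLeastLessThanSuc_atLeastAtMost)
    then show ?thesis by (simp add: tour_sum_def interior_sum_def Some Cons sum.reindex)
  qed (simp add: tour_sum_def interior_sum_def Some)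
qed (simp add: tour_sum_def interior_sum_def)

text \<open>The first step is uniform on \<open>exits I\<close>, so the factor in front turns the
  mean over exits into the boundary sum of the expected sums. The degree weights produced there
  cancel the division by degrees in \<open>tour_sum\<close>.\<close>

lemma
  fixes f :: "'a \<Rightarrow> real" and R s
  defines "D \<equiv> \<lambda>z. real (\<Sum>x\<in>I. card (nbrs H x - I)) * tour_sum H R f s z
    - (\<Sum>x\<in>V - I. f x * of_bool ((x, s) \<in> R))"
  shows integrable_tour_deviation: "integrable (tour_law H I) (\<lambda>z. D z ^ 4)"
    and expectation_tour_deviation: "measure_pmf.expectation (tour_law H I) D = 0"
proof -
  have "integrable (tour_law H I) (\<lambda>z. D z ^ 4) \<and> measure_pmf.expectation (tour_law H I) D = 0"
  proof (cases "exits I = {}")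
    case True
    \<comment> \<open>Without exits the supernode is the whole vertex set: both the factor and the
      sum over \<open>V - I\<close> vanish.\<close>
    then have "D = (\<lambda>_. 0)" unfolding D_def card_exits using exits_empty_imp by simp
    then show ?thesis by simp
  next
    case False
    define \<phi> where "\<phi> = (\<lambda>x. f x * of_bool ((x, s) \<in> R) / deg x)"
    define c where "c = (\<Sum>x\<in>V - I. f x * of_bool ((x, s) \<in> R))"
    have m: "real (card (exits I)) > 0" using False by (simp add: card_gt_0_iff)
    have arc: "(u, v) \<in> parcs H" if "(u, v) \<in> exits I" for u v using that by (auto simp: exits_def arc_iff_nbrs)
    have D: "D (map_option ((#) u) z) = card (exits I) * interior_sum \<phi> z + (- c)" for u z
      unfolding D_def card_exits tour_sum_Cons by (simp add: \<phi>_def c_def)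
    have set: "set_pmf (pmf_of_set (exits I)) \<subseteq> exits I" using False by simp
    have int4: "integrable (map_pmf (map_option ((#) u)) (nrw_until H I u v)) (\<lambda>z. D z ^ 4)"
      if "(u, v) \<in> exits I" for u v
      unfolding integrable_map_pmf_eq D
      by (rule measure_pmf.integrable_of_power4(4))
         (simp_all add: power_mult_distrib integrable_interior_sum[OF arc[OF that]])
    have int: "integrable (map_pmf (map_option ((#) u)) (nrw_until H I u v)) D"
      if "(u, v) \<in> exits I" for u v
      unfolding integrable_map_pmf_eq D using integrable_interior_sum(2)[OF arc[OF that]] by simp
    have E: "measure_pmf.expectation (map_pmf (map_option ((#) u)) (nrw_until H I u v)) D
        = card (exits I) * expected_sum \<phi> u v - c" if "(u, v) \<in> exits I" for u v
      unfolding integral_map_pmf D using integrable_interior_sum(2)[OF arc[OF that]] by simp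
    have "measure_pmf.expectation (tour_law H I) D
      = (\<Sum>(u, v)\<in>exits I. 1 / card (exits I) * (card (exits I) * expected_sum \<phi> u v - c))"
      unfolding tour_law_exits[OF False]
      by (subst integral_bind_pmf_finite[OF finite_exits set])
         (use int in \<open>auto simp: E False simp del: integral_map_pmf integrable_map_pmf_eq intro!: sum.cong\<close>)
    also have "\<dots> = (\<Sum>(u, v)\<in>exits I. expected_sum \<phi> u v) - c"
      using m False by (simp add: case_prod_unfold right_diff_distrib sum_subtractf)
    also have "(\<Sum>(u, v)\<in>exits I. expected_sum \<phi> u v) = (\<Sum>v\<in>V - I. deg v * \<phi> v)"
      unfolding exits_def using finite_subset[OF I(1) finite_verts]
      by (subst sum.Sigma[symmetric]) (auto simp: expected_sum_boundary)
    also have "\<dots> = c"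
      unfolding c_def \<phi>_def using deg_ge_1 by (intro sum.cong refl) force
    finally have "measure_pmf.expectation (tour_law H I) D = 0" by simp
    moreover have "integrable (tour_law H I) (\<lambda>z. D z ^ 4)"
      unfolding tour_law_exits[OF False]
      by (rule integrable_bind_pmf_finite[OF finite_exits set]) (use int4 in auto)
    ultimately show ?thesis by simp
  qed
  then show "integrable (tour_law H I) (\<lambda>z. D z ^ 4)" "measure_pmf.expectation (tour_law H I) D = 0"
    by simp_all
qed

end

end

section \<open>Consistency of the estimator\<close>

text \<open>Jensen's inequality for the fourth power, by Cauchy-Schwarz twice. It passes moment
  bounds from single visits to the mean over visits.\<close>

lemma sum_power4_le:
  fixes z :: "nat \<Rightarrow> real"
  shows "((\<Sum>i<t. \<bar>z i\<bar>) / real t) ^ 4 \<le> (\<Sum>i<t. z i ^ 4) / real t"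
proof (cases "t = 0")
  case False
  have "(\<Sum>i<t. \<bar>z i\<bar>)\<^sup>2 \<le> (\<Sum>i<t. (z i)\<^sup>2) * real t"
    using sum_squared_le_sum_of_squares[of "\<lambda>i. \<bar>z i\<bar>" "{..<t}"] by simp
  then have "((\<Sum>i<t. \<bar>z i\<bar>)\<^sup>2)\<^sup>2 \<le> ((\<Sum>i<t. (z i)\<^sup>2) * real t)\<^sup>2"
    by (intro power_mono) auto
  also have "\<dots> = (\<Sum>i<t. (z i)\<^sup>2)\<^sup>2 * (real t)\<^sup>2" by (simp add: power_mult_distrib)
  also have "\<dots> \<le> ((\<Sum>i<t. ((z i)\<^sup>2)\<^sup>2) * real t) * (real t)\<^sup>2"
    using sum_squared_le_sum_of_squares[of "\<lambda>i. (z i)\<^sup>2" "{..<t}"] by (intro mult_right_mono) auto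
  also have "\<dots> = (\<Sum>i<t. z i ^ 4) * real t ^ 3" by (simp add: power2_eq_square power3_eq_cube power4_eq_xxxx mult.assoc)
  finally have "(\<Sum>i<t. \<bar>z i\<bar>) ^ 4 \<le> (\<Sum>i<t. z i ^ 4) * real t ^ 3" by simp
  then have "(\<Sum>i<t. \<bar>z i\<bar>) ^ 4 / real t ^ 4 \<le> (\<Sum>i<t. z i ^ 4) * real t ^ 3 / real t ^ 4"
    by (intro divide_right_mono) auto
  also have "\<dots> = (\<Sum>i<t. z i ^ 4) / real t"
    using False by (simp add: power3_eq_cube power4_eq_xxxx)
  finally show ?thesis by (simp add: power_divide)
qed simp

section \<open>Deviations of the estimators along the walk\<close>

locale sampled_walk = graph_walk H M X
  for H :: "'a pair_pre_digraph" and M :: "'w measure" and X +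
  fixes R :: "'a rel" and I :: "'a \<Rightarrow> 'a set" and T :: "nat \<Rightarrow> nat \<Rightarrow> 'w \<Rightarrow> 'a list option"
  assumes equiv: "equiv (pverts H) R"
    and supernode: "\<And>s. s \<in> pverts H \<Longrightarrow> I s \<noteq> {}" "\<And>s. s \<in> pverts H \<Longrightarrow> I s \<subseteq> rel_class H R s"
    and tours: "tour_sampling M H I X T"
begin

abbreviation "F \<equiv> walk_algebra M H X"

lemma supernode_subset: "s \<in> V \<Longrightarrow> I s \<subseteq> V"
  using supernode(2) by (auto simp: rel_class_def)

lemma measurable_tours [measurable]: "T i r \<in> M \<rightarrow>\<^sub>M count_space UNIV"
  using tours unfolding tour_sampling_def by blast

lemma measurable_comp_tours [measurable]: "(\<lambda>\<omega>. f (T i r \<omega>)) \<in> M \<rightarrow>\<^sub>M borel"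
  by (rule measurable_compose[OF measurable_tours]) simp

lemma measurable_path: "(\<lambda>\<omega> i. X i \<omega>) \<in> M \<rightarrow>\<^sub>M (\<Pi>\<^sub>M i\<in>(UNIV :: nat set). count_space V)"
  by (rule measurable_PiM_single') (auto simp: walk_in_verts)

lemma subalgebra_walk: "subalgebra M F"
  unfolding subalgebra_def walk_algebra_def
  using measurable_sets[OF measurable_path] measurable_space[OF measurable_path]
  by (auto simp: sets_vimage_algebra2)

lemma walk_eq_in_walk_algebra: "{\<omega> \<in> space M. X i \<omega> = s} \<in> sets F"
proof (cases "s \<in> V")
  case True
  define A where "A = {x \<in> space (\<Pi>\<^sub>M i\<in>(UNIV :: nat set). count_space V). x i = s}"
  have "A = (\<lambda>x. x i) -` {s} \<inter> space (\<Pi>\<^sub>M i\<in>(UNIV :: nat set). count_space V)"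
    unfolding A_def by auto
  also have "\<dots> \<in> sets (\<Pi>\<^sub>M i\<in>(UNIV :: nat set). count_space V)"
    using True by (intro measurable_sets[OF measurable_component_singleton]) auto
  finally have "(\<lambda>\<omega> i. X i \<omega>) -` A \<inter> space M \<in> sets F"
    unfolding walk_algebra_def by (rule in_vimage_algebra)
  also have "(\<lambda>\<omega> i. X i \<omega>) -` A \<inter> space M = {\<omega> \<in> space M. X i \<omega> = s}"
    using measurable_space[OF measurable_path] unfolding A_def by auto
  finally show ?thesis .
next
  case False
  then have "{\<omega> \<in> space M. X i \<omega> = s} = {}" using walk_in_verts by auto
  then show ?thesis by (simp only: sets.empty_sets)
qed

interpretation cond: finite_measure_subalgebra M F
  by unfold_locales (rule subalgebra_walk)

text \<open>The event that visit \<open>i\<close> is at \<open>s\<close> belongs to the walk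
  algebra, and on it the prescribed conditional probability is a constant. Integrating over this
  event removes the conditional expectation.\<close>

lemma prob_tours:
  assumes J: "finite J"
  shows "prob {\<omega> \<in> space M. X i \<omega> = s \<and> (\<forall>r\<in>J. T i r \<omega> = \<tau> r)}
    = prob {\<omega> \<in> space M. X i \<omega> = s} * (\<Prod>r\<in>J. pmf (tour_law H (I s)) (\<tau> r))"
proof -
  define A where "A = {\<omega> \<in> space M. X i \<omega> = s}"
  define E where "E = {\<omega> \<in> space M. \<forall>(i, r)\<in>Pair i ` J. T i r \<omega> = \<tau> r}"
  let ?\<pi> = "\<Prod>r\<in>J. pmf (tour_law H (I s)) (\<tau> r)"
  have E_eq: "E = {\<omega> \<in> space M. \<forall>r\<in>J. T i r \<omega> = \<tau> r}" unfolding E_def by auto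
  have [measurable]: "E \<in> sets M"
    unfolding E_eq using J
  proof (intro sets.sets_Collect_finite_All)
    fix r
    show "{\<omega> \<in> space M. T i r \<omega> = \<tau> r} \<in> sets M"
      using measurable_sets[OF measurable_tours[of i r], of "{\<tau> r}"] by (simp add: vimage_def Int_def conj_commute)
  qed
  have [measurable]: "A \<in> sets M" unfolding A_def by measurable
  have AE: "AE \<omega> in M. real_cond_exp M F (indicator E) \<omega>
      = (\<Prod>(i, r)\<in>Pair i ` J. pmf (tour_law H (I (X i \<omega>))) (\<tau> r))"
    using tours J unfolding tour_sampling_def E_def
    by (elim conjE allE[of _ "Pair i ` J"] allE[of _ "\<lambda>_ r. \<tau> r"]) auto
  have "prob (A \<inter> E) = (\<integral>\<omega>\<in>A. indicator E \<omega> \<partial>M)"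
    by (simp add: set_lebesgue_integral_def flip: indicator_inter_arith)
  also have "\<dots> = (\<integral>\<omega>\<in>A. real_cond_exp M F (indicator E) \<omega> \<partial>M)"
    using walk_eq_in_walk_algebra unfolding A_def by (intro cond.real_cond_exp_intA) (auto simp: emeasure_eq_measure)
  also have "\<dots> = (\<integral>\<omega>. indicator A \<omega> * ?\<pi> \<partial>M)"
    unfolding set_lebesgue_integral_def
  proof (rule integral_cong_AE)
    show "AE \<omega> in M. indicator A \<omega> *\<^sub>R real_cond_exp M F (indicator E) \<omega> = indicator A \<omega> * ?\<pi>"
      using AE by eventually_elim (auto simp: indicator_def A_def prod.reindex inj_on_def)
  qed measurable
  also have "\<dots> = prob A * ?\<pi>" by simp
  also have "A \<inter> E = {\<omega> \<in> space M. X i \<omega> = s \<and> (\<forall>r\<in>J. T i r \<omega> = \<tau> r)}"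
    unfolding A_def E_eq by auto
  finally show ?thesis unfolding A_def .
qed

definition tour_deviation :: "('a \<Rightarrow> real) \<Rightarrow> 'a \<Rightarrow> 'a list option \<Rightarrow> real" where
  "tour_deviation f s z = real (\<Sum>x\<in>I s. card (nbrs H x - I s)) * tour_sum H R f s z
    - (\<Sum>x\<in>V - I s. f x * of_bool ((x, s) \<in> R))"

text \<open>The supernode part of the class sum is computed exactly; tours estimate only the part
  over \<open>V - I s\<close>, and \<open>tour_deviation\<close> is their centred error.\<close>

lemma tour_estimator_deviation:
  assumes "s \<in> V" "q > 0"
  shows "tour_estimator H R (I s) f s q \<tau> = class_sum H R f s + (\<Sum>r<q. tour_deviation f s (\<tau> r)) / real q"
proof -
  have "class_sum H R f s = (\<Sum>x\<in>V - I s. f x * of_bool ((x, s) \<in> R)) + (\<Sum>x\<in>I s. f x * of_bool ((x, s) \<in> R))"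
    unfolding class_sum_def by (rule sum.subset_diff[OF supernode_subset[OF assms(1)] finite_verts])
  then show ?thesis using assms(2)
    by (simp add: tour_estimator_def tour_deviation_def sum_subtractf diff_divide_distrib flip: sum_distrib_left)
qed

text \<open>Under the measure conditioned on \<open>X i = s\<close> the tours of visit
  \<open>i\<close> are i.i.d. with a fixed law. With \<open>e\<close> the fourth moment of one
  deviation, \<open>K = 1 + e\<close> bounds the second moment by
  \<open>x\<^sup>2 \<le> 1 + x ^ 4\<close>, and \<open>K\<^sup>2\<close> bounds \<open>e\<close>
  itself.\<close>

lemma fourth_moment_visit:
  fixes f :: "'a \<Rightarrow> real"
  assumes s: "s \<in> V"
  defines "K \<equiv> 1 + measure_pmf.expectation (tour_law H (I s)) (\<lambda>z. tour_deviation f s z ^ 4)"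
  shows "(\<integral>\<^sup>+\<omega>. ennreal ((\<Sum>r<q. tour_deviation f s (T i r \<omega>)) ^ 4) * indicator {\<omega> \<in> space M. X i \<omega> = s} \<omega> \<partial>M)
    \<le> ennreal (11 * K\<^sup>2 * (real q)\<^sup>2)"
proof -
  define A where "A = {\<omega> \<in> space M. X i \<omega> = s}"
  define p where "p = tour_law H (I s)"
  define D where "D r \<omega> = tour_deviation f s (T i r \<omega>)" for r \<omega>
  have [measurable]: "A \<in> sets M" unfolding A_def by measurable
  note sn = supernode_subset[OF s] supernode(1)[OF s]
  have int4: "integrable p (\<lambda>z. tour_deviation f s z ^ 4)"
    and mean: "measure_pmf.expectation p (tour_deviation f s) = 0"
    using integrable_tour_deviation[OF sn, where f=f and R=R and s=s]
      expectation_tour_deviation[OF sn, where f=f and R=R and s=s]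
    unfolding tour_deviation_def p_def by simp_all
  show ?thesis
  proof (cases "prob A = 0")
    \<comment> \<open>Conditioning on a null event is meaningless, but then the integral
      vanishes.\<close>
    case True
    then have "AE \<omega> in M. \<omega> \<notin> A" by (intro AE_not_in) (simp add: null_sets_def emeasure_eq_measure)
    then have "(\<integral>\<^sup>+\<omega>. ennreal ((\<Sum>r<q. tour_deviation f s (T i r \<omega>)) ^ 4) * indicator A \<omega> \<partial>M) = (\<integral>\<^sup>+\<omega>. 0 \<partial>M)"
      by (intro nn_integral_cong_AE) (auto elim!: eventually_mono)
    then show ?thesis unfolding A_def by simp
  next
    case False
    then have eA: "emeasure M A \<noteq> 0" "emeasure M A \<noteq> \<infinity>" by (simp_all add: emeasure_eq_measure)
    define N where "N = uniform_measure M A"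
    interpret N: prob_space N unfolding N_def by (rule prob_space_uniform_measure[OF eA])
    have sets_N[measurable_cong]: "sets N = sets M" unfolding N_def by simp
    have pt: "N.prob {\<omega> \<in> space N. \<forall>r\<in>J. T i r \<omega> = \<tau> r} = (\<Prod>r\<in>J. pmf p (\<tau> r))" if "finite J" for J \<tau>
    proof -
      have ev: "{\<omega> \<in> space M. \<forall>r\<in>J. T i r \<omega> = \<tau> r} \<in> sets M"
      proof (intro sets.sets_Collect_finite_All that)
        fix r
        show "{\<omega> \<in> space M. T i r \<omega> = \<tau> r} \<in> sets M"
          using measurable_sets[OF measurable_tours[of i r], of "{\<tau> r}"] by (simp add: vimage_def Int_def conj_commute)
      qed
      have "A \<inter> {\<omega> \<in> space M. \<forall>r\<in>J. T i r \<omega> = \<tau> r} = {\<omega> \<in> space M. X i \<omega> = s \<and> (\<forall>r\<in>J. T i r \<omega> = \<tau> r)}"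
        unfolding A_def by auto
      then show ?thesis
        using prob_tours[OF that, of i s \<tau>] False eA ev by (simp add: N_def p_def A_def)
    qed
    have meas: "T i r \<in> N \<rightarrow>\<^sub>M count_space UNIV" for r by measurable
    have borel: "h \<in> borel_measurable (count_space UNIV)" for h :: "'a list option \<Rightarrow> real"
      by (simp add: measurable_def)
    have distr: "distr N (count_space UNIV) (T i r) = measure_pmf p" for r
      by (rule N.distr_iid_pmf[OF meas]) (rule pt)
    have indep: "N.indep_vars (\<lambda>_. count_space UNIV) (T i) UNIV"
      by (rule N.indep_vars_iid_pmf[OF meas]) (rule pt)
    have E: "N.expectation (\<lambda>\<omega>. h (T i r \<omega>)) = measure_pmf.expectation p h" for h :: "'a list option \<Rightarrow> real" and r
      using integral_distr[OF meas[of r] borel[of h]] unfolding distr by (rule sym)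
    have D_indep: "N.indep_vars (\<lambda>_. borel) D UNIV"
      unfolding D_def by (rule N.indep_vars_compose2[OF indep borel])
    have D_int4: "integrable N (\<lambda>\<omega>. D r \<omega> ^ 4)" for r
      using integrable_distr_eq[OF meas[of r] borel, of "\<lambda>z. tour_deviation f s z ^ 4"] int4
      unfolding distr D_def by blast
    have D_mean: "N.expectation (D r) = 0" for r
      using E[of "tour_deviation f s" r] mean unfolding D_def by simp
    have D_2: "N.expectation (\<lambda>\<omega>. (D r \<omega>)\<^sup>2) \<le> K" for r
    proof -
      have int2: "integrable p (\<lambda>z. (tour_deviation f s z)\<^sup>2)"
        by (rule measure_pmf.integrable_of_power4(5)[where g="\<lambda>_. 1"]) (use int4 in simp_all)
      have "measure_pmf.expectation p (\<lambda>z. (tour_deviation f s z)\<^sup>2)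
          \<le> measure_pmf.expectation p (\<lambda>z. 1 + tour_deviation f s z ^ 4)"
        using int2 int4 by (intro integral_mono) (auto intro: abs_mult_power4_le(4))
      also have "\<dots> = K" using int4 by (simp add: K_def p_def)
      finally show ?thesis unfolding D_def by (subst E)
    qed
    have D_4: "N.expectation (\<lambda>\<omega>. D r \<omega> ^ 4) \<le> K\<^sup>2" for r
    proof -
      define e where "e = measure_pmf.expectation p (\<lambda>z. tour_deviation f s z ^ 4)"
      have "0 \<le> e" unfolding e_def by simp
      then have "e \<le> (1 + e)\<^sup>2" by (simp add: power2_eq_square algebra_simps)
      then show ?thesis unfolding D_def K_def p_def[symmetric] e_def by (subst E)
    qed
    note S4 = N.fourth_moment_iid[OF D_indep D_int4 D_mean D_2 D_4, of q]
    have "(\<integral>\<^sup>+\<omega>. ennreal ((\<Sum>r<q. D r \<omega>) ^ 4) * indicator A \<omega> \<partial>M)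
        = emeasure M A * (\<integral>\<^sup>+\<omega>. ennreal ((\<Sum>r<q. D r \<omega>) ^ 4) \<partial>N)"
    proof -
      have "a * (b / a) = b" if "a \<noteq> 0" "a \<noteq> \<infinity>" for a b :: ennreal
        using that by (metis ennreal_mult_divide_eq ennreal_times_divide infinity_ennreal_def mult.commute)
      then show ?thesis
        unfolding N_def D_def by (subst nn_integral_uniform_measure) (use eA in simp_all)
    qed
    also have "\<dots> \<le> 1 * (\<integral>\<^sup>+\<omega>. ennreal ((\<Sum>r<q. D r \<omega>) ^ 4) \<partial>N)"
      by (intro mult_right_mono emeasure_le_1) simp
    also have "\<dots> \<le> ennreal (11 * K\<^sup>2 * (real q)\<^sup>2)"
      using S4 by (simp add: nn_integral_eq_integral ennreal_leI)
    finally show ?thesis unfolding A_def D_def .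
  qed
qed

definition deviation :: "('a \<Rightarrow> real) \<Rightarrow> nat \<Rightarrow> nat \<Rightarrow> 'w \<Rightarrow> real" where
  "deviation f q i \<omega> = (\<Sum>r<q. tour_deviation f (X i \<omega>) (T i r \<omega>)) / real q"

text \<open>In \<open>deviation\<close> the random state selects the function applied to the tours.
  Splitting over the finitely many states makes this function fixed, which yields both measurability
  and moment bounds.\<close>

lemma deviation_eq:
  assumes "\<omega> \<in> space M"
  shows "deviation f q i \<omega> ^ 4
    = (\<Sum>s\<in>V. (\<Sum>r<q. tour_deviation f s (T i r \<omega>)) ^ 4 * indicator {\<omega> \<in> space M. X i \<omega> = s} \<omega>) / real q ^ 4"
proof -
  have "(\<Sum>s\<in>V. (\<Sum>r<q. tour_deviation f s (T i r \<omega>)) ^ 4 * indicator {\<omega> \<in> space M. X i \<omega> = s} \<omega>)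
    = (\<Sum>s\<in>V. if s = X i \<omega> then (\<Sum>r<q. tour_deviation f s (T i r \<omega>)) ^ 4 else 0)"
    using assms by (intro sum.cong refl) (auto simp: indicator_def)
  then show ?thesis
    using assms by (simp add: deviation_def power_divide finite_verts walk_in_verts)
qed

lemma measurable_deviation4 [measurable]: "(\<lambda>\<omega>. deviation f q i \<omega> ^ 4) \<in> borel_measurable M"
  by (subst measurable_cong[OF deviation_eq]) measurable

text \<open>Adding the constants of all states makes the bound uniform in the visit
  \<open>i\<close>. For \<open>q = 0\<close> both sides are 0 because division by 0 gives 0.\<close>

lemma fourth_moment_deviation:
  obtains C where "0 \<le> C" "\<And>i q. (\<integral>\<^sup>+\<omega>. deviation f q i \<omega> ^ 4 \<partial>M) \<le> ennreal (C * inverse (real q ^ 2))"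
proof -
  define K where "K s = 1 + measure_pmf.expectation (tour_law H (I s)) (\<lambda>z. tour_deviation f s z ^ 4)" for s
  define C where "C = (\<Sum>s\<in>V. 11 * (K s)\<^sup>2)"
  have "(\<integral>\<^sup>+\<omega>. deviation f q i \<omega> ^ 4 \<partial>M) \<le> ennreal (C * inverse (real q ^ 2))" for i q
  proof (cases "q = 0")
    case True
    then show ?thesis by (simp add: deviation_def)
  next
    case False
    have "(\<integral>\<^sup>+\<omega>. deviation f q i \<omega> ^ 4 \<partial>M)
      = (\<integral>\<^sup>+\<omega>. ennreal (inverse (real q ^ 4)) * (\<Sum>s\<in>V. ennreal ((\<Sum>r<q. tour_deviation f s (T i r \<omega>)) ^ 4)
          * indicator {\<omega> \<in> space M. X i \<omega> = s} \<omega>) \<partial>M)"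
    proof (rule nn_integral_cong)
      fix \<omega> assume "\<omega> \<in> space M"
      show "ennreal (deviation f q i \<omega> ^ 4) = ennreal (inverse (real q ^ 4)) * (\<Sum>s\<in>V. ennreal ((\<Sum>r<q. tour_deviation f s (T i r \<omega>)) ^ 4)
          * indicator {\<omega> \<in> space M. X i \<omega> = s} \<omega>)"
        unfolding deviation_eq[OF \<open>\<omega> \<in> space M\<close>] divide_inverse
        by (simp add: ennreal_mult sum_nonneg mult.commute ennreal_indicator flip: sum_ennreal)
    qed
    also have "\<dots> = ennreal (inverse (real q ^ 4)) * (\<Sum>s\<in>V. \<integral>\<^sup>+\<omega>. ennreal ((\<Sum>r<q. tour_deviation f s (T i r \<omega>)) ^ 4)
          * indicator {\<omega> \<in> space M. X i \<omega> = s} \<omega> \<partial>M)"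
      by (simp add: nn_integral_cmult nn_integral_sum)
    also have "\<dots> \<le> ennreal (inverse (real q ^ 4)) * (\<Sum>s\<in>V. ennreal (11 * (K s)\<^sup>2 * (real q)\<^sup>2))"
      unfolding K_def by (intro mult_left_mono sum_mono fourth_moment_visit) auto
    also have "\<dots> = ennreal (inverse (real q ^ 4) * (C * (real q)\<^sup>2))"
      by (simp add: C_def sum_distrib_right ennreal_mult sum_nonneg flip: sum_ennreal)
    also have "inverse (real q ^ 4) * (C * (real q)\<^sup>2) = C * inverse (real q ^ 2)"
      using False by (simp add: field_simps power2_eq_square power4_eq_xxxx)
    finally show ?thesis .
  qed
  moreover have "0 \<le> C" unfolding C_def by (intro sum_nonneg) simp
  ultimately show thesis using that by blast
qed

text \<open>Since \<open>q\<close> is at least \<open>c * t\<close>, the mean of the fourth powers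
  over \<open>t\<close> visits has expectation at most a constant over
  \<open>t\<^sup>2\<close>.\<close>

lemma AE_mean_deviation:
  assumes c: "c > 0"
  shows "AE \<omega> in M. (\<lambda>t. (\<Sum>i<t. \<bar>deviation f (nat \<lceil>c * real t\<rceil>) i \<omega>\<bar>) / real t) \<longlonglongrightarrow> 0"
proof -
  define q where "q t = nat \<lceil>c * real t\<rceil>" for t :: nat
  have q: "c * real t \<le> real (q t)" for t
    unfolding q_def by (rule of_nat_ceiling)
  obtain C where C: "0 \<le> C" "\<And>i q. (\<integral>\<^sup>+\<omega>. deviation f q i \<omega> ^ 4 \<partial>M) \<le> ennreal (C * inverse (real q ^ 2))"
    using fourth_moment_deviation by blast
  define W where "W t \<omega> = (\<Sum>i<t. deviation f (q t) i \<omega> ^ 4) / real t" for t \<omega>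
  have "AE \<omega> in M. (\<lambda>t. W t \<omega>) \<longlonglongrightarrow> 0"
  proof (rule AE_tendsto_0_if_summable_nn_integral[where c="\<lambda>t. C * inverse (c\<^sup>2) * inverse (real t ^ 2)"])
    show "summable (\<lambda>t. C * inverse (c\<^sup>2) * inverse (real t ^ 2))"
      by (intro summable_mult inverse_power_summable) auto
    show "W t \<in> borel_measurable M" for t unfolding W_def by measurable
    show "0 \<le> W t \<omega>" for t \<omega> unfolding W_def by (intro divide_nonneg_nonneg sum_nonneg) auto
    show "0 \<le> C * inverse (c\<^sup>2) * inverse (real t ^ 2)" for t using C(1) by simp
    show "(\<integral>\<^sup>+\<omega>. ennreal (W t \<omega>) \<partial>M) \<le> ennreal (C * inverse (c\<^sup>2) * inverse (real t ^ 2))" for t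
    proof (cases "t = 0")
      case True
      then show ?thesis by (simp add: W_def)
    next
      case False
      have "(\<integral>\<^sup>+\<omega>. ennreal (W t \<omega>) \<partial>M) = ennreal (inverse (real t)) * (\<Sum>i<t. \<integral>\<^sup>+\<omega>. deviation f (q t) i \<omega> ^ 4 \<partial>M)"
        unfolding W_def divide_inverse
        by (simp add: ennreal_mult sum_nonneg mult.commute nn_integral_cmult nn_integral_sum flip: sum_ennreal)
      also have "\<dots> \<le> ennreal (inverse (real t)) * (\<Sum>i<t. ennreal (C * inverse (real (q t) ^ 2)))"
        by (intro mult_left_mono sum_mono C) auto
      also have "\<dots> = ennreal (inverse (real t) * (real t * (C * inverse (real (q t) ^ 2))))"
        using C(1) by (simp add: ennreal_mult flip: ennreal_of_nat_eq_real_of_nat)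
      also have "inverse (real t) * (real t * (C * inverse (real (q t) ^ 2))) = C * inverse (real (q t) ^ 2)"
        using False by simp
      also have "ennreal (C * inverse (real (q t) ^ 2)) \<le> ennreal (C * inverse ((c * real t) ^ 2))"
        using C(1) c False q[of t] by (intro ennreal_leI mult_left_mono le_imp_inverse_le power_mono) auto
      also have "(c * real t) ^ 2 = c\<^sup>2 * real t ^ 2" by (simp add: power_mult_distrib)
      finally show ?thesis by (simp add: mult.assoc)
    qed
  qed
  then show ?thesis
  proof eventually_elim
    case (elim \<omega>)
    have "(\<lambda>t. ((\<Sum>i<t. \<bar>deviation f (q t) i \<omega>\<bar>) / real t) ^ 4) \<longlonglongrightarrow> 0"
    proof (rule Lim_null_comparison[OF _ elim])
      show "\<forall>\<^sub>F t in sequentially. norm (((\<Sum>i<t. \<bar>deviation f (q t) i \<omega>\<bar>) / real t) ^ 4) \<le> W t \<omega>"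
        unfolding W_def using sum_power4_le by (intro always_eventually allI) simp
    qed
    then show ?case unfolding q_def by (simp add: power_tendsto_0_iff)
  qed
qed

section \<open>From deviations to ratios and their limits\<close>

lemma class_sum_deg_ge_1:
  assumes "s \<in> V"
  shows "1 \<le> class_sum H R (\<lambda>x. deg x) s"
proof -
  have "(s, s) \<in> R" using equiv assms by (simp add: equiv_def refl_on_def)
  then have "1 \<le> deg s * of_bool ((s, s) \<in> R)" using deg_ge_1[OF assms] by simp
  also have "\<dots> \<le> class_sum H R (\<lambda>x. deg x) s"
    unfolding class_sum_def by (rule member_le_sum[OF assms _ finite_verts]) simp
  finally show ?thesis .
qed

text \<open>Any supernode vertex lies in the class and adds its full degree exactly, while the tour
  part is nonnegative. The bound therefore holds for every realisation of the tours, even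
  \<open>None\<close>.\<close>

lemma tour_estimator_deg_ge_1:
  assumes "s \<in> V"
  shows "1 \<le> tour_estimator H R (I s) (\<lambda>x. deg x) s q \<tau>"
proof -
  obtain x where x: "x \<in> I s" using supernode(1)[OF assms] by auto
  then have xs: "x \<in> V" "(x, s) \<in> R" using supernode(2)[OF assms] by (auto simp: rel_class_def)
  have "1 \<le> deg x * of_bool ((x, s) \<in> R)" using deg_ge_1 xs by simp
  also have "\<dots> \<le> (\<Sum>x\<in>I s. deg x * of_bool ((x, s) \<in> R))"
    using finite_subset[OF supernode_subset[OF assms] finite_verts] by (intro member_le_sum[OF x]) auto
  finally have "1 \<le> (\<Sum>x\<in>I s. deg x * of_bool ((x, s) \<in> R))" .
  moreover have "0 \<le> tour_sum H R (\<lambda>x. deg x) s z" for z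
    unfolding tour_sum_def by (auto split: option.splits intro!: sum_nonneg)
  then have "0 \<le> real (\<Sum>x\<in>I s. card (nbrs H x - I s)) / real q * (\<Sum>r<q. tour_sum H R (\<lambda>x. deg x) s (\<tau> r))"
    by (intro mult_nonneg_nonneg divide_nonneg_nonneg sum_nonneg of_nat_0_le_iff) auto
  ultimately show ?thesis unfolding tour_estimator_def by linarith
qed

definition class_ratio :: "('a \<Rightarrow> real) \<Rightarrow> 'a \<Rightarrow> real" where
  "class_ratio g s = class_sum H R g s / class_sum H R (\<lambda>x. deg x) s"

lemma visit_ratio_deviation:
  assumes \<omega>: "\<omega> \<in> space M" and q: "q > 0" and K: "\<bar>class_ratio g (X i \<omega>)\<bar> \<le> K"
  shows "\<bar>visit_ratio H R I g q (X i \<omega>) (\<lambda>r. T i r \<omega>) - class_ratio g (X i \<omega>)\<bar>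
    \<le> \<bar>deviation g q i \<omega>\<bar> + K * \<bar>deviation (\<lambda>x. deg x) q i \<omega>\<bar>"
proof -
  have s: "X i \<omega> \<in> V" using walk_in_verts[OF \<omega>] .
  define a1 a2 r1 r2 d1 d2 where defs: "a1 = tour_estimator H R (I (X i \<omega>)) g (X i \<omega>) q (\<lambda>r. T i r \<omega>)"
    "a2 = tour_estimator H R (I (X i \<omega>)) (\<lambda>x. deg x) (X i \<omega>) q (\<lambda>r. T i r \<omega>)"
    "r1 = class_sum H R g (X i \<omega>)" "r2 = class_sum H R (\<lambda>x. deg x) (X i \<omega>)"
    "d1 = deviation g q i \<omega>" "d2 = deviation (\<lambda>x. deg x) q i \<omega>"
  have a: "a1 = r1 + d1" "a2 = r2 + d2"
    unfolding defs deviation_def by (rule tour_estimator_deviation[OF s q])+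
  have ge: "1 \<le> a2" "1 \<le> r2" unfolding defs using tour_estimator_deg_ge_1[OF s] class_sum_deg_ge_1[OF s] by auto
  have K': "\<bar>r1 / r2\<bar> \<le> K" using K unfolding class_ratio_def defs .
  \<comment> \<open>Writing the error over \<open>a2\<close> alone leaves a numerator linear in the
    deviations, with the bounded true ratio as coefficient.\<close>
  have "a1 / a2 - r1 / r2 = (d1 - r1 / r2 * d2) / a2"
    using ge unfolding a(1) by (simp add: field_simps a(2))
  then have "\<bar>a1 / a2 - r1 / r2\<bar> = \<bar>d1 - r1 / r2 * d2\<bar> / a2" using ge by simp
  also have "\<dots> \<le> \<bar>d1 - r1 / r2 * d2\<bar> / 1" using ge by (intro divide_left_mono) auto
  also have "\<dots> \<le> \<bar>d1\<bar> + \<bar>r1 / r2\<bar> * \<bar>d2\<bar>"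
    using abs_triangle_ineq4[of d1 "r1 / r2 * d2"] by (simp add: abs_mult)
  also have "\<dots> \<le> \<bar>d1\<bar> + K * \<bar>d2\<bar>" using K' by (intro add_left_mono mult_right_mono) auto
  finally show ?thesis unfolding visit_ratio_def class_ratio_def defs .
qed

text \<open>The weight \<open>w\<close> treats normalisation and numerator together: it is the
  constant 1 for the former and the indicator of the pattern for the latter.\<close>

lemma AE_mean_visit_ratio:
  assumes c: "c > 0" and w: "\<And>x. \<bar>w x\<bar> \<le> 1"
  shows "AE \<omega> in M. (\<lambda>t. (\<Sum>i<t. visit_ratio H R I g (nat \<lceil>c * real t\<rceil>) (X i \<omega>) (\<lambda>r. T i r \<omega>) * w (X i \<omega>)) / real t)
    \<longlonglongrightarrow> (\<Sum>x\<in>V. deg x * (class_ratio g x * w x)) / vol"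
proof -
  obtain K where K: "\<And>x. x \<in> V \<Longrightarrow> \<bar>class_ratio g x\<bar> \<le> K"
    using finite_verts by (metis Max_ge finite_imageI imageI)
  show ?thesis
    using ergodic[of "\<lambda>x. class_ratio g x * w x"] AE_mean_deviation[OF c, of g]
      AE_mean_deviation[OF c, of "\<lambda>x. deg x"] AE_space
  proof eventually_elim
    case (elim \<omega>)
    define q where "q t = nat \<lceil>c * real t\<rceil>" for t :: nat
    define v where "v t i = visit_ratio H R I g (q t) (X i \<omega>) (\<lambda>r. T i r \<omega>)" for t i
    define r where "r i = class_ratio g (X i \<omega>)" for i
    let ?w = "\<lambda>i. w (X i \<omega>)"
    have null: "(\<lambda>t. (\<Sum>i<t. v t i * ?w i) / real t - (\<Sum>i<t. r i * ?w i) / real t) \<longlonglongrightarrow> 0"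
    proof (rule Lim_null_comparison)
      show "(\<lambda>t. (\<Sum>i<t. \<bar>deviation g (q t) i \<omega>\<bar>) / real t + K * ((\<Sum>i<t. \<bar>deviation (\<lambda>x. deg x) (q t) i \<omega>\<bar>) / real t)) \<longlonglongrightarrow> 0"
        using tendsto_add[OF elim(2) tendsto_mult[OF tendsto_const elim(3), of K]] unfolding q_def by simp
      show "\<forall>\<^sub>F t in sequentially. norm ((\<Sum>i<t. v t i * ?w i) / real t - (\<Sum>i<t. r i * ?w i) / real t)
        \<le> (\<Sum>i<t. \<bar>deviation g (q t) i \<omega>\<bar>) / real t + K * ((\<Sum>i<t. \<bar>deviation (\<lambda>x. deg x) (q t) i \<omega>\<bar>) / real t)"
        using eventually_gt_at_top[of 0]
      proof eventually_elim
        case (elim t)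
        have q: "q t > 0" unfolding q_def using c elim by simp
        have "\<bar>(\<Sum>i<t. v t i * ?w i) - (\<Sum>i<t. r i * ?w i)\<bar> = \<bar>\<Sum>i<t. (v t i - r i) * ?w i\<bar>"
          by (simp add: left_diff_distrib sum_subtractf)
        also have "\<dots> \<le> (\<Sum>i<t. \<bar>(v t i - r i) * ?w i\<bar>)" by (rule sum_abs)
        also have "\<dots> \<le> (\<Sum>i<t. \<bar>deviation g (q t) i \<omega>\<bar> + K * \<bar>deviation (\<lambda>x. deg x) (q t) i \<omega>\<bar>)"
        proof (rule sum_mono)
          fix i
          have "\<bar>(v t i - r i) * ?w i\<bar> \<le> \<bar>v t i - r i\<bar>"
            using w[of "X i \<omega>"] by (simp add: abs_mult mult_left_le)
          also have "\<dots> \<le> \<bar>deviation g (q t) i \<omega>\<bar> + K * \<bar>deviation (\<lambda>x. deg x) (q t) i \<omega>\<bar>"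
            unfolding v_def r_def
            by (rule visit_ratio_deviation[OF \<open>\<omega> \<in> space M\<close> q K]) (rule walk_in_verts[OF \<open>\<omega> \<in> space M\<close>])
          finally show "\<bar>(v t i - r i) * ?w i\<bar> \<le> \<bar>deviation g (q t) i \<omega>\<bar> + K * \<bar>deviation (\<lambda>x. deg x) (q t) i \<omega>\<bar>" .
        qed
        finally have "\<bar>(\<Sum>i<t. v t i * ?w i) - (\<Sum>i<t. r i * ?w i)\<bar> / real t
          \<le> (\<Sum>i<t. \<bar>deviation g (q t) i \<omega>\<bar> + K * \<bar>deviation (\<lambda>x. deg x) (q t) i \<omega>\<bar>) / real t"
          by (rule divide_right_mono) simp
        then show ?case
          by (simp add: sum.distrib add_divide_distrib sum_distrib_left flip: diff_divide_distrib)
      qed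
    qed
    show ?case
      using tendsto_add[OF null elim(1)] unfolding v_def r_def q_def by simp
  qed
qed

text \<open>Within one class the class sums, the class size and \<open>w\<close> are constant. The
  degrees add up to the denominator of \<open>class_ratio\<close>, so each class contributes its
  class sum times \<open>w\<close> once, which on the right is shared equally among its
  members.\<close>

lemma sum_class_ratio:
  assumes w: "\<And>x y. (x, y) \<in> R \<Longrightarrow> w x = w y"
  shows "(\<Sum>x\<in>V. deg x * (class_ratio g x * w x))
    = (\<Sum>x\<in>V. class_sum H R g x / real (card (rel_class H R x)) * w x)"
proof -
  have sym: "(x, y) \<in> R \<longleftrightarrow> (y, x) \<in> R" for x y using equiv by (auto simp: equiv_def sym_def)
  have trans: "(x, z) \<in> R" if "(x, y) \<in> R" "(y, z) \<in> R" for x y z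
    using equiv that unfolding equiv_def by (blast dest: transD)
  have cls: "rel_class H R x = rel_class H R y" "class_sum H R f x = class_sum H R f y" if "(x, y) \<in> R" for x y f
  proof -
    have "(z, x) \<in> R \<longleftrightarrow> (z, y) \<in> R" for z using that sym trans by blast
    then show "rel_class H R x = rel_class H R y" "class_sum H R f x = class_sum H R f y"
      by (simp_all add: rel_class_def class_sum_def)
  qed
  define n where "n x = real (card (rel_class H R x))" for x
  define \<beta> where "\<beta> x = class_sum H R g x * w x" for x
  define \<delta> where "\<delta> x = class_sum H R (\<lambda>x. deg x) x" for x
  have n: "n x > 0" if "x \<in> V" for x
  proof -
    have "x \<in> rel_class H R x" using that equiv by (auto simp: rel_class_def equiv_def refl_on_def)
    moreover have "finite (rel_class H R x)" unfolding rel_class_def using finite_verts by simp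
    ultimately show ?thesis unfolding n_def by (auto simp: card_gt_0_iff)
  qed
  have count: "(\<Sum>y\<in>V. of_bool ((x, y) \<in> R)) = n x" for x
    unfolding n_def rel_class_def using finite_verts by (subst sym) (simp add: of_bool_def sum.If_cases Int_def)
  have "(\<Sum>x\<in>V. deg x * (class_ratio g x * w x)) = (\<Sum>x\<in>V. deg x * \<beta> x / \<delta> x)"
    by (simp add: class_ratio_def \<beta>_def \<delta>_def)
  \<comment> \<open>Each term is spread evenly over its class. After swapping the sums, the factors
    constant on classes are read at \<open>y\<close>, and the inner sum of degrees becomes
    \<open>\<delta> y\<close>.\<close>
  also have "\<dots> = (\<Sum>x\<in>V. \<Sum>y\<in>V. of_bool ((x, y) \<in> R) * (deg x * \<beta> x / \<delta> x / n x))"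
  proof (intro sum.cong refl)
    fix x assume "x \<in> V"
    then show "deg x * \<beta> x / \<delta> x = (\<Sum>y\<in>V. of_bool ((x, y) \<in> R) * (deg x * \<beta> x / \<delta> x / n x))"
      unfolding sum_distrib_right[symmetric] count using n[of x] by simp
  qed
  also have "\<dots> = (\<Sum>y\<in>V. \<Sum>x\<in>V. of_bool ((x, y) \<in> R) * (deg x * \<beta> x / \<delta> x / n x))"
    by (rule sum.swap)
  also have "\<dots> = (\<Sum>y\<in>V. \<Sum>x\<in>V. (deg x * of_bool ((x, y) \<in> R)) * (\<beta> y / \<delta> y / n y))"
  proof (intro sum.cong refl)
    fix x y
    show "of_bool ((x, y) \<in> R) * (deg x * \<beta> x / \<delta> x / n x) = (deg x * of_bool ((x, y) \<in> R)) * (\<beta> y / \<delta> y / n y)"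
      using cls[of x y] w[of x y] by (cases "(x, y) \<in> R") (simp_all add: \<beta>_def \<delta>_def n_def)
  qed
  also have "\<dots> = (\<Sum>y\<in>V. \<delta> y * (\<beta> y / \<delta> y / n y))"
    unfolding sum_distrib_right[symmetric] \<delta>_def class_sum_def ..
  also have "\<dots> = (\<Sum>y\<in>V. class_sum H R g y / real (card (rel_class H R y)) * w y)"
    using class_sum_deg_ge_1 by (intro sum.cong refl) (force simp: \<beta>_def n_def \<delta>_def)
  finally show ?thesis .
qed

theorem F_hat_consistent:
  assumes c: "c > 0" and nonzero: "F_norm H R g \<noteq> 0"
    and \<rho>: "\<And>x y. (x, y) \<in> R \<Longrightarrow> \<rho> x = \<rho> y"
  shows "AE \<omega> in M. (\<lambda>t. F_hat H R \<rho> P I g t (nat \<lceil>c * real t\<rceil>) (\<lambda>i. X i \<omega>) (\<lambda>i r. T i r \<omega>) (d t \<omega>))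
    \<longlonglongrightarrow> F_true H R \<rho> P g"
proof -
  have w: "\<bar>1 :: real\<bar> \<le> 1" "\<And>x. \<bar>of_bool (\<rho> x = P) :: real\<bar> \<le> 1" by simp_all
  show ?thesis
    using AE_mean_visit_ratio[OF c, of "\<lambda>_. 1" g, OF w(1)]
      AE_mean_visit_ratio[OF c, of "\<lambda>x. of_bool (\<rho> x = P)" g, OF w(2)]
  proof eventually_elim
    case (elim \<omega>)
    define l where "l t = (\<Sum>i<t. visit_ratio H R I g (nat \<lceil>c * real t\<rceil>) (X i \<omega>) (\<lambda>r. T i r \<omega>))" for t
    define m where "m t = (\<Sum>i<t. visit_ratio H R I g (nat \<lceil>c * real t\<rceil>) (X i \<omega>) (\<lambda>r. T i r \<omega>) * of_bool (\<rho> (X i \<omega>) = P))" for t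
    define N where "N = (\<Sum>x\<in>V. class_sum H R g x / real (card (rel_class H R x)) * of_bool (\<rho> x = P))"
    have l: "(\<lambda>t. l t / real t) \<longlonglongrightarrow> F_norm H R g / vol"
      using elim(1) sum_class_ratio[of "\<lambda>_. 1" g] by (simp add: l_def F_norm_def)
    have m: "(\<lambda>t. m t / real t) \<longlonglongrightarrow> N / vol"
      using elim(2) sum_class_ratio[of "\<lambda>x. of_bool (\<rho> x = P)" g] \<rho> unfolding m_def N_def by fastforce
    have ne: "F_norm H R g / vol \<noteq> 0" using nonzero vol_pos by simp
    have "(\<lambda>t. (m t / real t) / (l t / real t)) \<longlonglongrightarrow> (N / vol) / (F_norm H R g / vol)"
      by (rule tendsto_divide[OF m l ne])
    also have "(N / vol) / (F_norm H R g / vol) = F_true H R \<rho> P g"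
      using vol_pos by (simp add: F_true_def N_def)
    finally have lim: "(\<lambda>t. (m t / real t) / (l t / real t)) \<longlonglongrightarrow> F_true H R \<rho> P g" .
    have ev: "\<forall>\<^sub>F t in sequentially. (m t / real t) / (l t / real t)
        = F_hat H R \<rho> P I g t (nat \<lceil>c * real t\<rceil>) (\<lambda>i. X i \<omega>) (\<lambda>i r. T i r \<omega>) (d t \<omega>)"
      using tendsto_imp_eventually_ne[OF l ne]
      by eventually_elim (auto simp: F_hat_def Let_def l_def m_def)
    show ?case by (rule Lim_transform_eventually[OF lim ev])
  qed
qed

end

section \<open>The higher-order network satisfies the graph assumptions\<close>

text \<open>An induced subgraph is determined by its vertex set, so there are at most as many as
  subsets of the finite vertex set.\<close>

lemma finite_connected_subgraphs:
  assumes "pair_graph G"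
  shows "finite (connected_subgraphs k G)"
proof -
  interpret pair_graph G by fact
  define sub where "sub A = \<lparr>pverts = A, parcs = {e \<in> parcs G. fst e \<in> A \<and> snd e \<in> A}\<rparr>" for A
  have "connected_subgraphs k G \<subseteq> sub ` Pow (pverts G)"
  proof
    fix S assume "S \<in> connected_subgraphs k G"
    then have "induced_subgraph (with_proj S) (with_proj G)"
      unfolding connected_subgraphs_def by blast
    then have "pverts S \<subseteq> pverts G" "parcs S = {e \<in> parcs G. fst e \<in> pverts S \<and> snd e \<in> pverts S}"
      by (auto simp: induced_subgraph_def subgraph_def)
    then show "S \<in> sub ` Pow (pverts G)" unfolding sub_def by (intro image_eqI[of _ _ "pverts S"]) auto
  qed
  then show ?thesis by (rule finite_subset) (simp add: pair_finite_verts)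
qed

lemma connected_closed_set:
  assumes conn: "Digraph_Component.connected (with_proj H)"
    and arcs: "\<And>x y. (x, y) \<in> parcs H \<Longrightarrow> (y, x) \<in> parcs H"
    and A: "A \<subseteq> pverts H" "A \<noteq> {}" "\<And>x. x \<in> A \<Longrightarrow> nbrs H x \<subseteq> A"
  shows "A = pverts H"
proof
  \<comment> \<open>Connectedness is defined as strong connectedness of the symmetric closure, which
    here has the same arcs.\<close>
  have sym: "parcs (mk_symmetric (with_proj H)) = parcs H"
    using arcs by (auto simp: parcs_mk_symmetric)
  obtain x where x: "x \<in> A" using A(2) by auto
  show "pverts H \<subseteq> A"
  proof
    fix y assume "y \<in> pverts H"
    then have "(x, y) \<in> rtrancl_on (pverts H) (parcs H)"
      using conn x A(1) unfolding Digraph_Component.connected_def strongly_connected_def reachable_def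
      by (auto simp: sym)
    then show "y \<in> A"
      by (induction rule: rtrancl_on_induct) (use x A(3) in \<open>auto simp: nbrs_def\<close>)
  qed
qed fact

lemma finite_connected_graph_hon:
  assumes graph: "pair_graph G"
    and conn: "Digraph_Component.connected (with_proj (hon k G))"
    and nonbip: "\<not> bipartite (hon k G)"
  shows "finite_connected_graph (hon k G)"
proof -
  let ?H = "hon k G"
  have sub: "parcs ?H \<subseteq> pverts ?H \<times> pverts ?H" by (auto simp: hon_def)
  have sym: "(y, x) \<in> parcs ?H" if "(x, y) \<in> parcs ?H" for x y
    using that by (auto simp: hon_def Int_commute)
  have irr: "A = pverts ?H" if "A \<subseteq> pverts ?H" "A \<noteq> {}" "\<And>x. x \<in> A \<Longrightarrow> nbrs ?H x \<subseteq> A" for A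
    using connected_closed_set[OF conn sym] that by blast
  \<comment> \<open>A graph without arcs is bipartite with one empty side, so non-bipartiteness
    supplies an arc and excludes the single isolated vertex, from which no walk could move.\<close>
  have "parcs ?H \<noteq> {}" using nonbip unfolding bipartite_def by auto
  then obtain a b where ab: "(a, b) \<in> parcs ?H" by auto
  have "nbrs ?H x \<noteq> {}" if x: "x \<in> pverts ?H" for x
  proof
    assume e: "nbrs ?H x = {}"
    \<comment> \<open>An isolated vertex is a closed set and hence the whole graph; the arc found
      above would then start and end at \<open>x\<close>.\<close>
    have "{x} = pverts ?H" by (rule irr) (use x e in auto)
    then have "b \<in> nbrs ?H x" using ab sub by (auto simp: nbrs_def)
    then show False using e by simp
  qed
  moreover have "finite (pverts ?H)" using finite_connected_subgraphs[OF graph] by (simp add: hon_def)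
  moreover have "pverts ?H \<noteq> {}" using ab sub by auto
  ultimately show ?thesis using sub sym irr by unfold_locales blast+
qed

theorem theorem2:
  fixes G :: "'v pair_pre_digraph" and \<Phi> :: "'v \<Rightarrow> 'l" and k :: nat
    and \<rho> :: "'v pair_pre_digraph \<Rightarrow> 'p" and P :: 'p
    and R :: "'v pair_pre_digraph rel" and g :: "'v pair_pre_digraph \<Rightarrow> real"
    and I :: "'v pair_pre_digraph \<Rightarrow> 'v pair_pre_digraph set"
    and M :: "'w measure" and X :: "nat \<Rightarrow> 'w \<Rightarrow> 'v pair_pre_digraph"
    and T :: "nat \<Rightarrow> nat \<Rightarrow> 'w \<Rightarrow> 'v pair_pre_digraph list option"
    and c :: real and d :: "nat \<Rightarrow> 'w \<Rightarrow> real"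
  assumes graph: "pair_graph G"
    and conn: "Digraph_Component.connected (with_proj (hon k G))"
    and nonbip: "\<not> bipartite (hon k G)"
    and pattern: "pattern_map \<Phi> k G \<rho>"
    and rel: "equivalence_isomorphic k G \<rho> R"
    and nonzero: "F_norm (hon k G) R g \<noteq> 0"
    and supernodes: "\<forall>S\<in>connected_subgraphs k G. I S \<noteq> {} \<and> I S \<subseteq> rel_class (hon k G) R S"
    and prob: "prob_space M"
    and walk: "simple_random_walk M (hon k G) X"
    and tours: "tour_sampling M (hon k G) I X T"
    and c_pos: "c > 0"
  shows "AE \<omega> in M.
    (\<lambda>t. F_hat (hon k G) R \<rho> P I g t (nat \<lceil>c * real t\<rceil>)
            (\<lambda>i. X i \<omega>) (\<lambda>i r. T i r \<omega>) (d t \<omega>))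
      \<longlonglongrightarrow> F_true (hon k G) R \<rho> P g"
proof -
  interpret finite_connected_graph "hon k G"
    by (rule finite_connected_graph_hon[OF graph conn nonbip])
  interpret prob_space M by (rule prob)
  have V: "pverts (hon k G) = connected_subgraphs k G" by (simp add: hon_def)
  interpret sampled_walk "hon k G" M X R I T
    by unfold_locales (use walk rel supernodes tours in \<open>auto simp: V equivalence_isomorphic_def\<close>)
  show ?thesis
    by (rule F_hat_consistent[OF c_pos nonzero]) (use rel in \<open>auto simp: equivalence_isomorphic_def\<close>)
qed

end
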